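(* Let $A$ be a Banach algebra with the property $\beta$, and let $Q=\{q\in A \mid \sigma(q)=\{0\}\}$ be the set of its quasinilpotent elements. If a derivation $d$ of $A$ satisfies $d(Q)\subseteq Q$, then $d(A)\subseteq \mathrm{rad}(A)$.
   Context: Banach algebras are complex and associative, not necessarily unital. For $a\in A$, $\sigma(a)$ denotes the spectrum of $a$ (computed in the unitization of $A$ when $A$ has no identity element). $\mathrm{rad}(A)$ denotes the Jacobson radical of $A$; recall that $\mathrm{rad}(A)=\{q\in A\mid qA\subseteq Q\}$. A derivation of $A$ is a linear map $d:A\to A$ with $d(xy)=d(x)y+xd(y)$ for all $x,y\in A$; it is not assumed to be continuous. A Banach algebra $A$ has the property $\beta$ if there exists a family $(\pi_i)_{i\in I}$ of continuous irreducible representations of $A$ on Banach spaces $X_i$ such that: (a) $\bigcap_{i}\ker\pi_i=\mathrm{rad}(A)$; and (b) for each $i$ with $\dim X_i\ge 2$ there exists $q\in A$ such that $q^2=0$ and $\pi_i(q)\neq 0$. Here irreducible means algebraically irreducible (the representation is nonzero and there are no invariant linear subspaces other than $\{0\}$ and $X_i$). The family may be empty, in which case the intersection in (a) is understood to be $A$. *)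

theory Defs
  imports "HOL-Analysis.Analysis"
begin

class complex_banach = banach +
  fixes scaleC :: "complex \<Rightarrow> 'a \<Rightarrow> 'a"  (infixr "*\<^sub>C" 75)
  assumes scaleC_add_right: "c *\<^sub>C (x + y) = c *\<^sub>C x + c *\<^sub>C y"
    and scaleC_add_left: "(b + c) *\<^sub>C x = b *\<^sub>C x + c *\<^sub>C x"
    and scaleC_scaleC: "b *\<^sub>C c *\<^sub>C x = (b * c) *\<^sub>C x"
    and scaleC_of_real: "complex_of_real r *\<^sub>C x = r *\<^sub>R x"
    and norm_scaleC: "norm (c *\<^sub>C x) = cmod c * norm x"

(* No identity is required, and one-element algebras are allowed. *)
class complex_banach_algebra = complex_banach + real_normed_algebra +
  assumes mult_scaleC_left: "(c *\<^sub>C x) * y = c *\<^sub>C (x * y)"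
    and mult_scaleC_right: "x * (c *\<^sub>C y) = c *\<^sub>C (x * y)"

global_interpretation complex_vector: vector_space "scaleC :: complex \<Rightarrow> 'a \<Rightarrow> 'a::complex_banach"
  defines csubspace = complex_vector.subspace
    and cdependent = complex_vector.dependent
proof
  fix x :: 'a
  show "1 *\<^sub>C x = x"
    using scaleC_of_real[of 1 x] by simp
qed (simp_all add: scaleC_add_right scaleC_add_left scaleC_scaleC)

definition is_identity :: "'a::complex_banach_algebra \<Rightarrow> bool" where
  "is_identity e \<longleftrightarrow> (\<forall>x. e * x = x \<and> x * e = x)"

(* The pair (a, b) stands for a + b 1 in the unitization, whose identity is (0, 1). *)
definition unitization_mult ::
  "'a::complex_banach_algebra \<times> complex \<Rightarrow> 'a \<times> complex \<Rightarrow> 'a \<times> complex" where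
  "unitization_mult u v =
     (fst u * fst v + snd v *\<^sub>C fst u + snd u *\<^sub>C fst v, snd u * snd v)"

definition spectrum :: "'a::complex_banach_algebra \<Rightarrow> complex set" where
  "spectrum a =
     (if \<exists>e::'a. is_identity e
      then {z. \<not> (\<exists>e b. is_identity e \<and> (a - z *\<^sub>C e) * b = e \<and> b * (a - z *\<^sub>C e) = e)}
      else {z. \<not> (\<exists>v. unitization_mult (a, - z) v = (0, 1) \<and> unitization_mult v (a, - z) = (0, 1))})"

definition quasinilpotents :: "'a::complex_banach_algebra set" where
  "quasinilpotents = {q. spectrum q = {0}}"

definition left_ideal :: "'a::complex_banach_algebra set \<Rightarrow> bool" where
  "left_ideal L \<longleftrightarrow> csubspace L \<and> (\<forall>a. \<forall>x\<in>L. a * x \<in> L)"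

definition modular_left_ideal :: "'a::complex_banach_algebra set \<Rightarrow> bool" where
  "modular_left_ideal L \<longleftrightarrow> left_ideal L \<and> (\<exists>u. \<forall>a. a - a * u \<in> L)"

definition maximal_modular_left_ideal :: "'a::complex_banach_algebra set \<Rightarrow> bool" where
  "maximal_modular_left_ideal L \<longleftrightarrow>
     modular_left_ideal L \<and> L \<noteq> UNIV \<and>
     (\<forall>M. left_ideal M \<and> L \<subseteq> M \<longrightarrow> M = L \<or> M = UNIV)"

(* The whole algebra if there are no maximal modular left ideals. *)
definition jacobson_radical :: "'a::complex_banach_algebra set" where
  "jacobson_radical = \<Inter> {L. maximal_modular_left_ideal L}"

definition derivation :: "('a::complex_banach_algebra \<Rightarrow> 'a) \<Rightarrow> bool" where
  "derivation d \<longleftrightarrow>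
     Vector_Spaces.linear scaleC scaleC d \<and> (\<forall>x y. d (x * y) = d x * y + x * d y)"

(* The Banach space carrying a representation is a closed complex subspace X of the type 'x.
   Only the restrictions of the maps p a to X matter.  The bound M expresses continuity of the
   homomorphism from the algebra to the bounded operators on X (with the operator norm). *)
definition continuous_representation ::
  "'x::complex_banach set \<Rightarrow> ('a::complex_banach_algebra \<Rightarrow> 'x \<Rightarrow> 'x) \<Rightarrow> bool" where
  "continuous_representation X p \<longleftrightarrow>
     csubspace X \<and> closed X \<and>
     (\<forall>a. \<forall>x\<in>X. p a x \<in> X) \<and>
     (\<forall>a. \<forall>x\<in>X. \<forall>y\<in>X. p a (x + y) = p a x + p a y) \<and>
     (\<forall>a c. \<forall>x\<in>X. p a (c *\<^sub>C x) = c *\<^sub>C p a x) \<and>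
     (\<forall>a b. \<forall>x\<in>X. p (a + b) x = p a x + p b x) \<and>
     (\<forall>a c. \<forall>x\<in>X. p (c *\<^sub>C a) x = c *\<^sub>C p a x) \<and>
     (\<forall>a b. \<forall>x\<in>X. p (a * b) x = p a (p b x)) \<and>
     (\<exists>M. \<forall>a. \<forall>x\<in>X. norm (p a x) \<le> M * norm a * norm x)"

definition rep_kernel ::
  "'x::complex_banach set \<Rightarrow> ('a::complex_banach_algebra \<Rightarrow> 'x \<Rightarrow> 'x) \<Rightarrow> 'a set" where
  "rep_kernel X p = {a. \<forall>x\<in>X. p a x = 0}"

definition irreducible_representation ::
  "'x::complex_banach set \<Rightarrow> ('a::complex_banach_algebra \<Rightarrow> 'x \<Rightarrow> 'x) \<Rightarrow> bool" where
  "irreducible_representation X p \<longleftrightarrow>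
     rep_kernel X p \<noteq> UNIV \<and>
     (\<forall>Y. csubspace Y \<and> Y \<subseteq> X \<and> (\<forall>a. \<forall>y\<in>Y. p a y \<in> Y) \<longrightarrow> Y = {0} \<or> Y = X)"

(* A family of Banach spaces embeds isometrically, as closed subspaces, into its l_infinity-sum,
   so families of subspaces of one Banach space 'x cover all families.  HOL has no quantifier
   over types; the index type 'i and the ambient space 'x are therefore parameters.  In a
   theorem they are free type variables, so that assuming property_beta TYPE('i) TYPE('x)
   TYPE('a) amounts to assuming a family over some index set and some Banach spaces.
   The dimension condition is expressed by a linearly independent pair, because the library's
   dim is 0 on infinite-dimensional spaces. *)
definition property_beta ::
  "'i itself \<Rightarrow> 'x::complex_banach itself \<Rightarrow> 'a::complex_banach_algebra itself \<Rightarrow> bool" where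
  "property_beta _ _ _ \<longleftrightarrow>
     (\<exists>(I :: 'i set) (X :: 'i \<Rightarrow> 'x set) (p :: 'i \<Rightarrow> 'a \<Rightarrow> 'x \<Rightarrow> 'x).
        (\<forall>i\<in>I. continuous_representation (X i) (p i) \<and> irreducible_representation (X i) (p i)) \<and>
        (\<Inter>i\<in>I. rep_kernel (X i) (p i)) = jacobson_radical \<and>
        (\<forall>i\<in>I. (\<exists>B\<subseteq>X i. card B = 2 \<and> \<not> cdependent B) \<longrightarrow>
           (\<exists>q. q * q = 0 \<and> q \<notin> rep_kernel (X i) (p i))))"

end

theory Submission
  imports Defs
begin

text \<open>
  It is enough to show that \<open>d a\<close> acts as 0 in every representation of the given family, because
  the radical is the intersection of the kernels.  No continuity of \<open>d\<close> is known, so \<open>d\<close> does not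
  pass to the images of the representations; the two kinds of representations are treated by
  different arguments.

  \<^emph>\<open>Dimension at least 2.\<close>  All elements \<open>q\<close> with \<open>q\<^sup>2 = 0\<close> are quasinilpotent, hence by
  hypothesis so are their derivatives, and a quasinilpotent element has no nonzero eigenvalue in any representation
  (\<open>quasinilpotent_no_eigenvalue\<close>).  Applied to \<open>d (q a q)\<close>, with \<open>a\<close> chosen by the density theorem,
  this gives \<open>(d q) q = 0\<close> in the representation (\<open>d_annihilates_range\<close>).  The same relation for
  the conjugates of \<open>q\<close> by \<open>1 + t a\<close>, expanded in powers of \<open>t\<close>, yields \<open>q (d a) q = 0\<close> and
  \<open>q a (d a) q = 0\<close>.  If \<open>q\<close> acts as a nonzero operator, these relations and density force \<open>d a\<close> to
  act as 0 for all \<open>a\<close> (\<open>derivation_into_kernel\<close>).  The density theorem for pairs of vectors rests on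
  the fact that only scalars commute with an irreducible representation (\<open>commutant_scalar\<close>), which
  needs the open mapping theorem and Liouville's theorem.

  \<^emph>\<open>Dimension 1.\<close>  Such representations are characters.  Let \<open>a\<close> be an element at which all of
  them vanish.  Then \<open>(d a) a\<close> is in the kernel of every representation of the family, hence in the
  radical, so \<open>d ((d a) a)\<close> is quasinilpotent; a character \<open>f\<close> maps it to \<open>(f (d a))\<^sup>2\<close>, which therefore is 0.  So \<open>d\<close>
  preserves the common kernel of the characters, and \<open>character_derivation_eq_0\<close> applies: this is
  the theorem of Johnson and of Singer and Wermer that a semisimple commutative Banach algebra has no
  nonzero derivations, continuous or not.  A gliding hump shows that \<open>f \<circ> d\<close> is unbounded for at most finitely
  many characters \<open>f\<close> (\<open>finite_unbounded_characters\<close>); each of these would be isolated and then have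
  \<open>f \<circ> d = 0\<close>, so there are none (\<open>bounded_if_finitely_many_unbounded\<close>); and in the bounded case the
  growth of the iterated derivatives of powers excludes \<open>f \<circ> d \<noteq> 0\<close>
  (\<open>bounded_character_derivation_eq_0\<close>).
\<close>

section \<open>Consequences of Baire's theorem\<close>

text \<open>
  This is the Baire half of the open mapping theorem, for the projection of \<open>G\<close> to its first
  coordinate: \<open>X\<close> is the union of the sets \<open>V n\<close> of points that have a partner of norm at most
  \<open>n\<close>, so one of their closures contains a relative ball.  Differences of points of that ball fill
  a neighbourhood of 0, and scaling turns this into approximation of every \<open>x\<close>.
\<close>

lemma approximate_selection:
  fixes G :: "('b::banach \<times> 'c::real_normed_vector) set"
  assumes G: "subspace G" and X: "closed X" "fst ` G = X"
  obtains K where "K \<ge> 0"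
    and "\<And>x. x \<in> X \<Longrightarrow> \<exists>x' y. (x', y) \<in> G \<and> norm (x - x') \<le> norm x / 2 \<and> norm y \<le> K * norm x"
proof -
  define V where "V n = {x. \<exists>y. (x, y) \<in> G \<and> norm y \<le> real n}" for n
  have zero: "(0, 0) \<in> G"
    using subspace_0[OF G] by (simp add: zero_prod_def)
  have VX: "closure (V n) \<subseteq> X" for n
    by (rule closure_minimal) (use X in \<open>force simp: V_def\<close>)+
  have cover: "\<Union> (range (\<lambda>n. closure (V n))) = X"
  proof
    show "X \<subseteq> \<Union> (range (\<lambda>n. closure (V n)))"
    proof
      fix x assume "x \<in> X"
      then obtain y where "(x, y) \<in> G" using X by force
      moreover obtain n where "norm y \<le> real n" using real_arch_simple by blast
      ultimately have "x \<in> V n" by (auto simp: V_def)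
      then show "x \<in> \<Union> (range (\<lambda>n. closure (V n)))"
        using closure_subset by blast
    qed
  qed (use VX in auto)
  have "\<exists>n. top_of_set X interior_of (closure (V n)) \<noteq> {}"
  proof (rule ccontr)
    assume *: "\<nexists>n. top_of_set X interior_of (closure (V n)) \<noteq> {}"
    have "completely_metrizable_space (top_of_set X)"
      using X by (simp add: completely_metrizable_space_closedin completely_metrizable_space_euclidean)
    then have "top_of_set X interior_of \<Union> (range (\<lambda>n. closure (V n))) = {}"
      using * VX by (intro Baire_category_alt) (auto intro!: closed_subset)
    then have "X = {}"
      unfolding cover using interior_of_topspace[of "top_of_set X"] by simp
    then show False using zero X by force
  qed
  then obtain n x0 where "x0 \<in> top_of_set X interior_of (closure (V n))" by blast
  then obtain U where "openin (top_of_set X) U" "x0 \<in> U" "U \<subseteq> closure (V n)"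
    unfolding interior_of_def by blast
  then obtain r where r: "r > 0" "x0 \<in> X" "ball x0 r \<inter> X \<subseteq> closure (V n)"
    by (meson openin_contains_ball order_trans subsetD)
  have subX: "x + c *\<^sub>R z \<in> X" if xz: "x \<in> X" "z \<in> X" for x z c
  proof -
    obtain y where "(x, y) \<in> G" using xz(1) X by force
    moreover obtain w where "(z, w) \<in> G" using xz(2) X by force
    ultimately have "(x, y) + c *\<^sub>R (z, w) \<in> G"
      using G by (blast intro: subspace_add subspace_scale)
    then have "(x + c *\<^sub>R z, y + c *\<^sub>R w) \<in> G"
      by simp
    then show ?thesis using X by (force simp: image_iff)
  qed
  show thesis
  proof (rule that)
    show "4 * real n / r \<ge> 0" using r by simp
    fix x assume x: "x \<in> X"
    show "\<exists>x' y. (x', y) \<in> G \<and> norm (x - x') \<le> norm x / 2 \<and> norm y \<le> 4 * real n / r * norm x"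
    proof (cases "x = 0")
      case True
      then show ?thesis using zero by (intro exI[of _ 0]) auto
    next
      case False
      define t where "t = r / (2 * norm x)"
      have t: "t > 0" using r False by (simp add: t_def)
      have "x0 + t *\<^sub>R x \<in> ball x0 r"
        using r False by (simp add: dist_norm t_def)
      then have "x0 + t *\<^sub>R x \<in> closure (V n)" "x0 \<in> closure (V n)"
        using r x subX by auto
      moreover have "r / 8 > 0" using r by simp
      ultimately obtain u v where u: "u \<in> V n" "dist u (x0 + t *\<^sub>R x) < r / 8"
        and v: "v \<in> V n" "dist v x0 < r / 8"
        unfolding closure_approachable by meson
      obtain y1 y2 where y: "(u, y1) \<in> G" "norm y1 \<le> n" "(v, y2) \<in> G" "norm y2 \<le> n"
        using u v by (auto simp: V_def)
      have "(1 / t) *\<^sub>R ((u, y1) - (v, y2)) \<in> G"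
        using y G by (blast intro: subspace_diff subspace_scale)
      then have "((1 / t) *\<^sub>R (u - v), (1 / t) *\<^sub>R (y1 - y2)) \<in> G"
        by simp
      moreover have "norm (x - (1 / t) *\<^sub>R (u - v)) \<le> norm x / 2"
      proof -
        have "x - (1 / t) *\<^sub>R (u - v) = (1 / t) *\<^sub>R ((x0 + t *\<^sub>R x - u) + (v - x0))"
          using t by (simp add: algebra_simps)
        also have "norm \<dots> \<le> (1 / t) * (r / 8 + r / 8)"
        proof -
          have "norm ((x0 + t *\<^sub>R x - u) + (v - x0)) \<le> r / 8 + r / 8"
            using u(2) v(2) by (intro norm_triangle_mono) (auto simp: dist_norm norm_minus_commute)
          from mult_left_mono[OF this, of "1 / t"] show ?thesis using t by (simp only: norm_scaleR) simp
        qed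
        also have "\<dots> = norm x / 2" using r by (simp add: t_def)
        finally show ?thesis .
      qed
      moreover have "norm ((1 / t) *\<^sub>R (y1 - y2)) \<le> 4 * real n / r * norm x"
      proof -
        have "norm (y1 - y2) \<le> 2 * real n"
          using y(2,4) norm_triangle_ineq4[of y1 y2] by linarith
        then have "norm ((1 / t) *\<^sub>R (y1 - y2)) \<le> (1 / t) * (2 * real n)"
          using t by (simp add: divide_right_mono)
        also have "\<dots> = 4 * real n / r * norm x" using r by (simp add: t_def)
        finally show ?thesis .
      qed
      ultimately show ?thesis by blast
    qed
  qed
qed

text \<open>
  A closed linear relation plays the role of both the closed graph and the open mapping theorem:
  the approximation is iterated on the remainders, which halve in each step, so that the partners
  form an absolutely convergent series.  The relational form matters because it is applied to maps
  that are only defined modulo the common kernel of a family of functionals, where the quotient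
  space would otherwise be needed.
\<close>

proposition bounded_selection:
  fixes G :: "('b::banach \<times> 'c::banach) set"
  assumes G: "subspace G" "closed G" and X: "closed X" "fst ` G = X"
  shows "\<exists>C\<ge>0. \<forall>x\<in>X. \<exists>y. (x, y) \<in> G \<and> norm y \<le> C * norm x"
proof -
  obtain K where K: "K \<ge> 0"
    "\<And>x. x \<in> X \<Longrightarrow> \<exists>x' y. (x', y) \<in> G \<and> norm (x - x') \<le> norm x / 2 \<and> norm y \<le> K * norm x"
    using approximate_selection[OF G(1) X] by blast
  then obtain s g where sg: "\<And>x. x \<in> X \<Longrightarrow> (s x, g x) \<in> G"
    "\<And>x. x \<in> X \<Longrightarrow> norm (x - s x) \<le> norm x / 2" "\<And>x. x \<in> X \<Longrightarrow> norm (g x) \<le> K * norm x"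
    by metis
  have diffX: "x - s x \<in> X" if x: "x \<in> X" for x
  proof -
    obtain y where "(x, y) \<in> G" using x X by force
    then have "(x, y) - (s x, g x) \<in> G" using G sg(1)[OF x] by (blast intro: subspace_diff)
    then have "(x - s x, y - g x) \<in> G" by simp
    then show ?thesis using X by (force simp: image_iff)
  qed
  have "\<exists>y. (x, y) \<in> G \<and> norm y \<le> 2 * K * norm x" if x: "x \<in> X" for x
  proof -
    define e where "e k = ((\<lambda>x. x - s x) ^^ k) x" for k
    have eX: "e k \<in> X" for k
      by (induction k) (auto simp: e_def x diffX)
    have eS: "e (Suc k) = e k - s (e k)" for k by (simp add: e_def)
    have e: "norm (e k) \<le> norm x * (1/2) ^ k" for k
    proof (induction k)
      case (Suc k)
      then show ?case using sg(2)[OF eX[of k]] by (simp add: eS)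
    qed (simp add: e_def)
    have gb: "norm (g (e k)) \<le> K * norm x * (1/2) ^ k" for k
      using order_trans[OF sg(3)[OF eX[of k]] mult_left_mono[OF e[of k] K(1)]] by (simp add: mult_ac)
    have geo: "(\<lambda>k. K * norm x * (1/2) ^ k) sums (K * norm x * 2)"
      using sums_mult[OF geometric_sums[of "1/2::real"], of "K * norm x"] by simp
    have summ: "summable (\<lambda>k. g (e k))"
      by (rule summable_comparison_test[OF _ sums_summable[OF geo]]) (use gb in auto)
    have part: "(x - e m, \<Sum>k<m. g (e k)) \<in> G" for m
    proof (induction m)
      case 0
      then show ?case using subspace_0[OF G(1)] by (simp add: e_def zero_prod_def)
    next
      case (Suc m)
      have "(x - e m, \<Sum>k<m. g (e k)) + (s (e m), g (e m)) \<in> G"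
        using Suc G sg(1)[OF eX] by (blast intro: subspace_add)
      then show ?case by (simp add: eS algebra_simps)
    qed
    have "(\<lambda>m. norm x * (1/2) ^ m) \<longlonglongrightarrow> norm x * 0"
      by (intro tendsto_mult_left LIMSEQ_realpow_zero) auto
    then have "e \<longlonglongrightarrow> 0"
      using e by (intro Lim_null_comparison[of e "\<lambda>k. norm x * (1/2) ^ k"]) auto
    then have "(\<lambda>m. x - e m) \<longlonglongrightarrow> x"
      using tendsto_diff[OF tendsto_const[of x]] by fastforce
    moreover have "(\<lambda>m. \<Sum>k<m. g (e k)) \<longlonglongrightarrow> (\<Sum>k. g (e k))"
      using summ by (rule summable_LIMSEQ)
    ultimately have "(\<lambda>m. (x - e m, \<Sum>k<m. g (e k))) \<longlonglongrightarrow> (x, \<Sum>k. g (e k))"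
      by (rule tendsto_Pair)
    then have "(x, \<Sum>k. g (e k)) \<in> G"
      using closed_sequentially[OF G(2), of "\<lambda>m. (x - e m, \<Sum>k<m. g (e k))"] part by blast
    moreover have "norm (\<Sum>k. g (e k)) \<le> 2 * K * norm x"
    proof -
      have "norm (\<Sum>k. g (e k)) \<le> (\<Sum>k. K * norm x * (1/2) ^ k)"
        by (rule norm_suminf_le[OF gb sums_summable[OF geo]])
      also have "\<dots> = 2 * K * norm x" using sums_unique[OF geo] by simp
      finally show ?thesis .
    qed
    ultimately show ?thesis by blast
  qed
  then show ?thesis using K by (intro exI[of _ "2 * K"]) auto
qed

lemma interior_proper_subspace:
  fixes T :: "'b::real_normed_vector set"
  assumes "subspace T" "T \<noteq> UNIV"
  shows "interior T = {}"
proof (rule ccontr)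
  assume "interior T \<noteq> {}"
  then obtain x e where e: "e > 0" "ball x e \<subseteq> T"
    by (meson ex_in_conv mem_interior)
  have "z \<in> T" for z
  proof -
    define t where "t = e / (2 * (norm z + 1))"
    have t: "t > 0" using e by (simp add: t_def add_nonneg_pos)
    have "t * norm z < e"
    proof -
      have "t * norm z \<le> t * (norm z + 1)" using t by simp
      also have "\<dots> = e / 2"
        using add_nonneg_pos[OF norm_ge_zero[of z] zero_less_one] by (simp add: t_def field_simps)
      finally show ?thesis using e by simp
    qed
    then have "x + t *\<^sub>R z \<in> T" "x \<in> T"
      using e t by (auto simp: dist_norm)
    then have "(1 / t) *\<^sub>R (x + t *\<^sub>R z - x) \<in> T"
      using assms(1) by (blast intro: subspace_diff subspace_scale)
    then show "z \<in> T" using t by simp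
  qed
  then show False using assms(2) by auto
qed

text \<open>
  The kernels are closed proper subspaces, hence have empty interior, and by Baire's theorem
  countably many of them do not cover the space.
\<close>

lemma countable_common_nonzero:
  fixes f :: "nat \<Rightarrow> 'b::banach \<Rightarrow> complex"
  assumes "\<And>n. bounded_linear (f n)" "\<And>n. \<exists>x. f n x \<noteq> 0"
  shows "\<exists>x. \<forall>n. f n x \<noteq> 0"
proof (rule ccontr)
  assume none: "\<nexists>x. \<forall>n. f n x \<noteq> 0"
  have "euclidean interior_of \<Union> (range (\<lambda>n. {x. f n x = 0})) = {}"
  proof (rule Baire_category_alt)
    fix T assume "T \<in> range (\<lambda>n. {x. f n x = 0})"
    then obtain n where T: "T = {x. f n x = 0}" by blast
    interpret bounded_linear "f n" by fact
    have "subspace T" unfolding T by (auto simp: subspace_def add scaleR zero)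
    moreover have "T \<noteq> UNIV" using assms(2)[of n] T by auto
    ultimately have "interior T = {}"
      by (rule interior_proper_subspace)
    moreover have "closed T" unfolding T
      by (intro closed_Collect_eq continuous_on continuous_intros)
    ultimately show "closedin euclidean T \<and> euclidean interior_of T = {}"
      by simp
  qed (auto simp: completely_metrizable_space_euclidean)
  moreover have "\<Union> (range (\<lambda>n. {x. f n x = 0})) = UNIV" using none by auto
  ultimately show False by simp
qed

section \<open>Liouville's theorem for functions with values in a Banach space\<close>

lemma bounded_bilinear_scaleC: "bounded_bilinear (scaleC :: complex \<Rightarrow> 'x \<Rightarrow> 'x::complex_banach)"
proof
  fix r :: real and c :: complex and x :: 'x
  show "(r *\<^sub>R c) *\<^sub>C x = r *\<^sub>R (c *\<^sub>C x)"
    by (simp add: scaleC_of_real[symmetric] scaleC_scaleC scaleR_conv_of_real)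
  show "c *\<^sub>C (r *\<^sub>R x) = r *\<^sub>R (c *\<^sub>C x)"
    by (simp add: scaleC_of_real[symmetric] scaleC_scaleC mult.commute)
  show "\<exists>K. \<forall>c x. norm (c *\<^sub>C (x::'x)) \<le> cmod c * norm x * K"
    by (rule exI[of _ 1]) (simp add: norm_scaleC)
qed (simp_all add: scaleC_add_left scaleC_add_right)

interpretation scaleC: bounded_bilinear "scaleC :: complex \<Rightarrow> 'x \<Rightarrow> 'x::complex_banach"
  by (rule bounded_bilinear_scaleC)

lemma scaleC_one [simp]: "1 *\<^sub>C (x::'x::complex_banach) = x"
  by (rule complex_vector.scale_one)

text \<open>
  Circle means take the place of the usual passage to scalar functions by continuous functionals:
  the integral \<open>J s\<close> of \<open>f\<close> over the circle of radius \<open>exp s\<close> has derivative 0, since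
  differentiating \<open>f (exp (s + i t))\<close> by \<open>s\<close> and by \<open>t\<close> gives the same up to the factor \<open>\<i>\<close>, and the
  derivative by \<open>t\<close> integrates to 0 over a period.  The constant is \<open>2 \<pi> f 0\<close> for \<open>s\<close> towards minus
  infinity and 0 for \<open>s\<close> towards infinity.
\<close>

theorem liouville_vector:
  fixes f :: "complex \<Rightarrow> 'x::complex_banach"
  assumes der: "\<And>z. (f has_derivative (\<lambda>h. h *\<^sub>C f' z)) (at z)"
    and cont: "continuous_on UNIV f'"
    and lim: "(f \<longlongrightarrow> 0) at_infinity"
  shows "f 0 = 0"
proof -
  define w :: "real \<Rightarrow> real \<Rightarrow> complex" where "w s t = exp (Complex s t)" for s t
  define J where "J s = integral (cbox 0 (2 * pi)) (\<lambda>t. f (w s t))" for s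
  have contf: "continuous_on UNIV f"
    by (intro continuous_at_imp_continuous_on ballI has_derivative_continuous[OF der])
  have w_eq: "w s t = exp (of_real s + \<i> * of_real t)" for s t
    by (simp add: w_def Complex_eq)
  have normw: "norm (w s t) = exp s" for s t by (simp add: w_def)
  have ds: "((\<lambda>s. f (w s t)) has_vector_derivative w s t *\<^sub>C f' (w s t)) (at s within U)" for s t U
  proof -
    have "((\<lambda>s. w s t) has_vector_derivative w s t) (at s within U)"
    proof -
      have "((\<lambda>s. of_real s + \<i> * of_real t) has_vector_derivative 1) (at s within U)"
        by (auto intro!: derivative_eq_intros simp: has_vector_derivative_def scaleR_conv_of_real)
      from field_vector_diff_chain_within[OF this DERIV_subset[OF DERIV_exp subset_UNIV]]
      show ?thesis by (simp add: w_eq o_def)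
    qed
    then have "((\<lambda>s. f (w s t)) has_derivative (\<lambda>h. (h *\<^sub>R w s t) *\<^sub>C f' (w s t))) (at s within U)"
      unfolding has_vector_derivative_def by (rule has_derivative_compose[OF _ der])
    then show ?thesis unfolding has_vector_derivative_def by (simp add: scaleC.scaleR_left)
  qed
  have dt: "((\<lambda>t. f (w s t)) has_vector_derivative \<i> *\<^sub>C (w s t *\<^sub>C f' (w s t))) (at t within U)" for s t U
  proof -
    have "((\<lambda>t. w s t) has_vector_derivative \<i> * w s t) (at t within U)"
    proof -
      have "((\<lambda>t. of_real s + \<i> * of_real t) has_vector_derivative \<i>) (at t within U)"
        by (auto intro!: derivative_eq_intros simp: has_vector_derivative_def scaleR_conv_of_real)
      from field_vector_diff_chain_within[OF this DERIV_subset[OF DERIV_exp subset_UNIV]]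
      show ?thesis by (simp add: w_eq o_def)
    qed
    then have "((\<lambda>t. f (w s t)) has_derivative (\<lambda>h. (h *\<^sub>R (\<i> * w s t)) *\<^sub>C f' (w s t))) (at t within U)"
      unfolding has_vector_derivative_def by (rule has_derivative_compose[OF _ der])
    then show ?thesis unfolding has_vector_derivative_def
      by (simp add: scaleC.scaleR_left scaleC_scaleC)
  qed
  have contw: "continuous_on A (\<lambda>(s, t). w s t)" for A
    unfolding w_eq split_def by (intro continuous_intros)
  have contfw: "continuous_on A (\<lambda>t. f (w s t))" for s A
    unfolding w_eq by (intro continuous_on_compose2[OF contf] continuous_intros) auto
  have zero: "integral (cbox 0 (2 * pi)) (\<lambda>t. w s t *\<^sub>C f' (w s t)) = 0" for s
  proof -
    have "((\<lambda>t. \<i> *\<^sub>C (w s t *\<^sub>C f' (w s t))) has_integral f (w s (2 * pi)) - f (w s 0)) {0..2 * pi}"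
      by (intro fundamental_theorem_of_calculus dt) simp
    moreover have "w s (2 * pi) = w s 0"
      by (simp add: w_eq exp_add mult.commute[of \<i>])
    ultimately have "((\<lambda>t. \<i> *\<^sub>C (w s t *\<^sub>C f' (w s t))) has_integral 0) {0..2 * pi}"
      by (simp only: diff_self)
    from has_integral_linear[OF this scaleC.bounded_linear_right[of "- \<i>"]]
    show ?thesis
      by (simp add: o_def scaleC_scaleC scaleC.zero_right integral_unique)
  qed
  have "(J has_vector_derivative 0) (at s within UNIV)" for s
    unfolding J_def zero[of s, symmetric]
  proof (rule leibniz_rule_vector_derivative)
    show "(\<lambda>t. f (w s t)) integrable_on cbox 0 (2 * pi)" for s
      by (intro integrable_continuous contfw)
    show "continuous_on (UNIV \<times> cbox 0 (2 * pi)) (\<lambda>(x, t). w x t *\<^sub>C f' (w x t))"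
      unfolding split_def
      by (intro scaleC.continuous_on continuous_on_compose2[OF cont] contw[unfolded split_def]) auto
  qed (auto intro: ds)
  then obtain c where c: "\<And>s. J s = c"
    using has_vector_derivative_zero_constant[of UNIV J] by auto
  have bound: "norm (J s - (2 * pi) *\<^sub>R v) \<le> 2 * pi * e"
    if "\<And>z. norm z = exp s \<Longrightarrow> norm (f z - v) \<le> e" for s v e
  proof -
    have int: "(\<lambda>t. f (w s t)) integrable_on {0..2 * pi}"
      unfolding box_real(2)[symmetric] by (intro integrable_continuous contfw)
    have "J s - (2 * pi) *\<^sub>R v = integral {0..2 * pi} (\<lambda>t. f (w s t) - v)"
      using integral_diff[OF int integrable_const_ivl[of v]] by (simp add: J_def)
    also have "norm \<dots> \<le> e * (2 * pi - 0)"
      by (rule integral_bound) (auto intro!: that continuous_intros contfw simp: normw)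
    finally show ?thesis by (simp add: mult.commute)
  qed
  have "c = 0"
  proof (rule ccontr)
    assume "c \<noteq> 0"
    define e where "e = norm c / (4 * pi)"
    have "e > 0" using \<open>c \<noteq> 0\<close> by (simp add: e_def)
    then obtain b where b: "\<And>z. norm z \<ge> b \<Longrightarrow> norm (f z) < e"
      using lim unfolding tendsto_iff eventually_at_infinity by auto
    have "norm (J (ln (max b 1)) - (2 * pi) *\<^sub>R 0) \<le> 2 * pi * e"
      by (rule bound) (use b in \<open>force intro: less_imp_le\<close>)
    then show False using \<open>c \<noteq> 0\<close> c by (simp add: e_def)
  qed
  show "f 0 = 0"
  proof (rule ccontr)
    assume "f 0 \<noteq> 0"
    define e where "e = norm (f 0) / 2"
    have "e > 0" using \<open>f 0 \<noteq> 0\<close> by (simp add: e_def)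
    moreover have "isCont f 0" using contf by (simp add: continuous_on_eq_continuous_at)
    ultimately obtain r where r: "r > 0" "\<And>z. dist z 0 < r \<Longrightarrow> dist (f z) (f 0) < e"
      unfolding continuous_at_eps_delta by blast
    have "norm (J (ln (r / 2)) - (2 * pi) *\<^sub>R f 0) \<le> 2 * pi * e"
      by (rule bound) (use r in \<open>auto simp: dist_norm intro: less_imp_le\<close>)
    then show False using \<open>f 0 \<noteq> 0\<close> c \<open>c = 0\<close> by (simp add: e_def)
  qed
qed

section \<open>Irreducible representations\<close>

locale banach_representation =
  fixes X :: "'x::complex_banach set" and p :: "'a::complex_banach_algebra \<Rightarrow> 'x \<Rightarrow> 'x"
  assumes rep: "continuous_representation X p"
begin

lemma subspace_carrier: "csubspace X"
  using rep by (simp add: continuous_representation_def)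

lemma closed_carrier: "closed X"
  using rep by (simp add: continuous_representation_def)

lemma zero_in [simp]: "0 \<in> X"
  by (rule complex_vector.subspace_0[OF subspace_carrier])

lemma add_in [simp]: "x \<in> X \<Longrightarrow> y \<in> X \<Longrightarrow> x + y \<in> X"
  by (rule complex_vector.subspace_add[OF subspace_carrier])

lemma diff_in [simp]: "x \<in> X \<Longrightarrow> y \<in> X \<Longrightarrow> x - y \<in> X"
  by (rule complex_vector.subspace_diff[OF subspace_carrier])

lemma scale_in [simp]: "x \<in> X \<Longrightarrow> c *\<^sub>C x \<in> X"
  by (rule complex_vector.subspace_scale[OF subspace_carrier])

lemma act_in [simp]: "x \<in> X \<Longrightarrow> p a x \<in> X"
  using rep by (simp add: continuous_representation_def)

lemma act_add [simp]: "x \<in> X \<Longrightarrow> y \<in> X \<Longrightarrow> p a (x + y) = p a x + p a y"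
  using rep by (simp add: continuous_representation_def)

lemma act_scale [simp]: "x \<in> X \<Longrightarrow> p a (c *\<^sub>C x) = c *\<^sub>C p a x"
  using rep by (simp add: continuous_representation_def)

lemma add_act [simp]: "x \<in> X \<Longrightarrow> p (a + b) x = p a x + p b x"
  using rep by (simp add: continuous_representation_def)

lemma scale_act [simp]: "x \<in> X \<Longrightarrow> p (c *\<^sub>C a) x = c *\<^sub>C p a x"
  using rep by (simp add: continuous_representation_def)

lemma mult_act [simp]: "x \<in> X \<Longrightarrow> p (a * b) x = p a (p b x)"
  using rep by (simp add: continuous_representation_def)

lemma act_diff [simp]: "x \<in> X \<Longrightarrow> y \<in> X \<Longrightarrow> p a (x - y) = p a x - p a y"
  by (metis act_add diff_in add_diff_cancel_right' diff_add_cancel)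

lemma act_zero [simp]: "p a 0 = 0"
  using act_diff[of 0 0 a] by simp

lemma diff_act [simp]: "x \<in> X \<Longrightarrow> p (a - b) x = p a x - p b x"
  by (metis add_act add_diff_cancel_right' diff_add_cancel)

lemma zero_act [simp]: "x \<in> X \<Longrightarrow> p 0 x = 0"
  using diff_act[of x 0 0] by simp

lemma scaleR_act: "x \<in> X \<Longrightarrow> p (r *\<^sub>R a) x = r *\<^sub>R p a x"
  by (simp flip: scaleC_of_real)

lemma act_bound: "\<exists>M\<ge>0. \<forall>a. \<forall>x\<in>X. norm (p a x) \<le> M * norm a * norm x"
proof -
  obtain M where M: "\<forall>a. \<forall>x\<in>X. norm (p a x) \<le> M * norm a * norm x"
    using rep unfolding continuous_representation_def by blast
  have "norm (p a x) \<le> \<bar>M\<bar> * norm a * norm x" if "x \<in> X" for a x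
  proof -
    have "M * (norm a * norm x) \<le> \<bar>M\<bar> * (norm a * norm x)"
      by (rule mult_right_mono) auto
    moreover have "norm (p a x) \<le> M * norm a * norm x" using M that by simp
    ultimately show ?thesis by (simp add: mult.assoc)
  qed
  then show ?thesis by (intro exI[of _ "\<bar>M\<bar>"]) auto
qed

lemma bounded_linear_orbit:
  assumes "x \<in> X" shows "bounded_linear (\<lambda>a. p a x)"
proof -
  obtain M where M: "M \<ge> 0" "\<And>(a::'a) z. z \<in> X \<Longrightarrow> norm (p a z) \<le> M * norm a * norm z"
    using act_bound by auto
  then show ?thesis using assms
    by (intro bounded_linear_intro[where K = "M * norm x"]) (auto simp: scaleR_act mult_ac)
qed

end

locale irreducible_banach_representation = banach_representation X p
  for X :: "'x::complex_banach set" and p :: "'a::complex_banach_algebra \<Rightarrow> 'x \<Rightarrow> 'x" +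
  assumes irr: "irreducible_representation X p"
begin

lemma invariant_subspace:
  assumes "csubspace Y" "Y \<subseteq> X" "\<And>a y. y \<in> Y \<Longrightarrow> p a y \<in> Y"
  shows "Y = {0} \<or> Y = X"
  using irr assms unfolding irreducible_representation_def by (elim conjE allE[of _ Y]) simp

lemma nontrivial: obtains a x where "x \<in> X" "p a x \<noteq> 0"
  using irr unfolding irreducible_representation_def rep_kernel_def by auto

text \<open>
  The vectors that are annihilated by the whole algebra form an invariant subspace.
\<close>

lemma annihilated_eq_0:
  assumes x: "x \<in> X" and "\<And>a. p a x = 0"
  shows "x = 0"
proof -
  let ?Y = "{x \<in> X. \<forall>a. p a x = 0}"
  have "?Y = {0} \<or> ?Y = X"
    by (rule invariant_subspace) (auto simp: complex_vector.subspace_def scaleC.zero_right mult_act[symmetric] simp del: mult_act)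
  moreover obtain a y where "y \<in> X" "p a y \<noteq> 0" by (rule nontrivial)
  then have "?Y \<noteq> X" by auto
  ultimately show ?thesis using assms by blast
qed

lemma orbit_onto:
  assumes x: "x \<in> X" "x \<noteq> 0" and v: "v \<in> X"
  obtains a where "p a x = v"
proof -
  let ?Y = "range (\<lambda>a. p a x)"
  have "?Y = {0} \<or> ?Y = X"
  proof (rule invariant_subspace)
    show "csubspace ?Y"
      unfolding complex_vector.subspace_def
    proof (intro conjI ballI allI)
      show "0 \<in> ?Y" using x by (auto intro: image_eqI[of _ _ 0])
    next
      fix u v assume "u \<in> ?Y" "v \<in> ?Y"
      then show "u + v \<in> ?Y" using x by (auto simp: add_act[symmetric] simp del: add_act)
    next
      fix c v assume "v \<in> ?Y"
      then show "c *\<^sub>C v \<in> ?Y" using x by (auto simp: scale_act[symmetric] simp del: scale_act)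
    qed
  qed (use x in \<open>auto simp: mult_act[symmetric] simp del: mult_act\<close>)
  moreover have "?Y \<noteq> {0}" using annihilated_eq_0[of x] x by blast
  ultimately show thesis using v that by (metis imageE)
qed

lemma orbit_onto_bounded:
  assumes x: "x \<in> X" "x \<noteq> 0"
  shows "\<exists>C\<ge>0. \<forall>v\<in>X. \<exists>a. p a x = v \<and> norm a \<le> C * norm v"
proof -
  interpret L: bounded_linear "\<lambda>a. p a x" by (rule bounded_linear_orbit[OF x(1)])
  let ?G = "{va. fst va = p (snd va) x}"
  have "subspace ?G" using x by (auto simp: subspace_def L.scaleR)
  moreover have "closed ?G"
    by (intro closed_Collect_eq L.continuous_on continuous_intros)
  moreover have "fst ` ?G = X"
  proof
    show "X \<subseteq> fst ` ?G"
    proof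
      fix v assume "v \<in> X"
      then obtain a where "p a x = v" by (rule orbit_onto[OF x])
      then show "v \<in> fst ` ?G" by (intro image_eqI[of _ _ "(v, a)"]) auto
    qed
  qed (use x in auto)
  ultimately have "\<exists>C\<ge>0. \<forall>v\<in>X. \<exists>a. (v, a) \<in> ?G \<and> norm a \<le> C * norm v"
    by (intro bounded_selection closed_carrier)
  then show ?thesis by (simp add: eq_commute)
qed

end

lemma isCont_of_Lipschitz_bound:
  fixes g :: "'b::metric_space \<Rightarrow> 'c::metric_space"
  assumes "e > 0" "\<And>z. dist z m < e \<Longrightarrow> dist (g z) (g m) \<le> L * dist z m"
  shows "isCont g m"
proof -
  have "((\<lambda>z. L * dist z m) \<longlongrightarrow> L * dist m m) (at m)"
    by (intro tendsto_intros)
  then have lim: "((\<lambda>z. L * dist z m) \<longlongrightarrow> 0) (at m)" by simp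
  have "\<forall>\<^sub>F z in at m. dist (g z) (g m) \<le> L * dist z m"
    using assms by (auto simp: eventually_at)
  then have "((\<lambda>z. dist (g z) (g m)) \<longlongrightarrow> 0) (at m)"
    by (intro tendsto_sandwich[OF _ _ tendsto_const lim]) auto
  then show ?thesis unfolding isCont_def by (rule iffD2[OF tendsto_dist_iff])
qed

context irreducible_banach_representation
begin

text \<open>
  This combines Schur's lemma with the theorem of Gelfand and Mazur.  Under the assumption, the
  action on \<open>x\<close> determines the action on \<open>y\<close>, so \<open>p a x \<mapsto> p a y\<close> is an operator \<open>T\<close> on \<open>X\<close> that
  commutes with the representation.  If \<open>y\<close> were no multiple of \<open>x\<close>, then \<open>T - l\<close> would be invertible
  for every complex \<open>l\<close>; its inverse \<open>R l\<close> sends \<open>p a (y - l x)\<close> to \<open>p a x\<close> and is bounded by the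
  open mapping theorem.  The resolvent identity makes \<open>l \<mapsto> R l x\<close> an entire function that tends to
  0 at infinity, which contradicts Liouville's theorem.
\<close>

theorem commutant_scalar:
  assumes x: "x \<in> X" "x \<noteq> 0" and y: "y \<in> X"
    and ann: "\<And>a. p a x = 0 \<Longrightarrow> p a y = 0"
  shows "\<exists>c. y = c *\<^sub>C x"
proof (rule ccontr)
  assume "\<nexists>c. y = c *\<^sub>C x"
  then have z: "y - l *\<^sub>C x \<in> X" "y - l *\<^sub>C x \<noteq> 0" for l
    using x y by auto
  define R where "R l v = p (SOME a. p a (y - l *\<^sub>C x) = v) x" for l v
  \<comment> \<open>This makes \<open>R l\<close> well defined.  The possible values \<open>p a x\<close> form an invariant subspace.  If it
    were everything, some \<open>e\<close> with \<open>p e x = x\<close> would annihilate \<open>y - l x\<close>; as \<open>a - a e\<close> acts as 0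
    on \<open>x\<close> and hence on \<open>y\<close>, every \<open>a\<close> would annihilate \<open>y - l x\<close>.\<close>
  have inj: "p a x = 0" if a: "p a (y - l *\<^sub>C x) = 0" for a l
  proof -
    let ?Y = "(\<lambda>a. p a x) ` {a. p a (y - l *\<^sub>C x) = 0}"
    have "?Y = {0} \<or> ?Y = X"
    proof (rule invariant_subspace)
      show "csubspace ?Y"
        unfolding complex_vector.subspace_def
      proof (intro conjI ballI allI)
        show "0 \<in> ?Y" using x y by (intro image_eqI[of _ _ 0]) auto
      next
        fix u v assume "u \<in> ?Y" "v \<in> ?Y"
        then obtain a b where "u = p a x" "p a (y - l *\<^sub>C x) = 0" "v = p b x" "p b (y - l *\<^sub>C x) = 0"
          by blast
        then show "u + v \<in> ?Y" using x z by (intro image_eqI[of _ _ "a + b"]) (simp_all del: act_diff)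
      next
        fix c v assume "v \<in> ?Y"
        then obtain a where "v = p a x" "p a (y - l *\<^sub>C x) = 0" by blast
        then show "c *\<^sub>C v \<in> ?Y" using x z by (intro image_eqI[of _ _ "c *\<^sub>C a"]) (simp_all del: act_diff add: scaleC.zero_right)
      qed
      show "p b w \<in> ?Y" if w: "w \<in> ?Y" for b w
      proof -
        obtain a where "w = p a x" "p a (y - l *\<^sub>C x) = 0" using w by blast
        then show ?thesis using x z by (intro image_eqI[of _ _ "b * a"]) (simp_all del: act_diff)
      qed
    qed (use x in auto)
    moreover have "?Y \<noteq> X"
    proof
      assume "?Y = X"
      then obtain e where e: "x = p e x" "p e (y - l *\<^sub>C x) = 0" using x by blast
      have "p a (y - l *\<^sub>C x) = 0" for a
      proof -
        have "p (a - a * e) x = 0" using x e(1) by simp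
        then have "p (a - a * e) (y - l *\<^sub>C x) = 0" using ann x y by (simp add: scaleC.zero_right)
        then have "p a (y - l *\<^sub>C x) - p a (p e (y - l *\<^sub>C x)) = 0" using z by (simp del: act_diff)
        then show ?thesis using e(2) by (simp del: act_diff)
      qed
      then show False using annihilated_eq_0 z by blast
    qed
    ultimately show ?thesis using a by auto
  qed
  have R: "R l (p a (y - l *\<^sub>C x)) = p a x" for l a
  proof -
    let ?b = "SOME b. p b (y - l *\<^sub>C x) = p a (y - l *\<^sub>C x)"
    have "p ?b (y - l *\<^sub>C x) = p a (y - l *\<^sub>C x)" by (rule someI) simp
    then have "p (?b - a) (y - l *\<^sub>C x) = 0" using diff_act[OF z(1)] by (simp del: act_diff)
    then have "p (?b - a) x = 0" by (rule inj)
    then show ?thesis using x by (simp add: R_def)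
  qed
  have R_in [simp]: "R l v \<in> X" for l v
    using x by (simp add: R_def)
  have R_add: "R l (u + v) = R l u + R l v" and R_scale: "R l (c *\<^sub>C u) = c *\<^sub>C R l u"
    if uv: "u \<in> X" "v \<in> X" for l u v c
  proof -
    obtain a where a: "p a (y - l *\<^sub>C x) = u" by (rule orbit_onto[OF z(1) z(2) uv(1)])
    obtain b where b: "p b (y - l *\<^sub>C x) = v" by (rule orbit_onto[OF z(1) z(2) uv(2)])
    note ab = a b
    have "u + v = p (a + b) (y - l *\<^sub>C x)" "c *\<^sub>C u = p (c *\<^sub>C a) (y - l *\<^sub>C x)"
      using add_act[OF z(1)] scale_act[OF z(1)] ab by simp_all
    then show "R l (u + v) = R l u + R l v" "R l (c *\<^sub>C u) = c *\<^sub>C R l u"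
      using x R[of l a] R[of l b] R[of l "a + b"] R[of l "c *\<^sub>C a"] ab by simp_all
  qed
  have R_diff: "R l (u - v) = R l u - R l v" if "u \<in> X" "v \<in> X" for l u v
    by (metis R_add that diff_in add_diff_cancel_right' diff_add_cancel)
  have R_bound: "\<exists>B>0. \<forall>v\<in>X. norm (R l v) \<le> B * norm v" for l
  proof -
    obtain C where C: "C \<ge> 0" "\<And>v. v \<in> X \<Longrightarrow> \<exists>a. p a (y - l *\<^sub>C x) = v \<and> norm a \<le> C * norm v"
      using orbit_onto_bounded[OF z(1)[of l] z(2)[of l]] by blast
    obtain M where M: "M \<ge> 0" "\<And>a x. x \<in> X \<Longrightarrow> norm (p a x) \<le> M * norm a * norm x"
      using act_bound by auto
    show ?thesis
    proof (intro exI[of _ "M * C * norm x + 1"] conjI ballI)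
      show "0 < M * C * norm x + 1" using M C by (simp add: add_nonneg_pos)
      fix v assume "v \<in> X"
      then obtain a where a: "p a (y - l *\<^sub>C x) = v" "norm a \<le> C * norm v" using C by blast
      have "norm (R l v) \<le> M * norm a * norm x" using R[of l a] a M x by simp
      also have "\<dots> \<le> M * (C * norm v) * norm x"
        using a M by (intro mult_right_mono mult_left_mono) auto
      also have "\<dots> \<le> (M * C * norm x + 1) * norm v" by (simp add: algebra_simps)
      finally show "norm (R l v) \<le> (M * C * norm x + 1) * norm v" .
    qed
  qed
  \<comment> \<open>Expand \<open>v = p a (y - l x)\<close> as \<open>p a (y - m x) + (m - l) (p a x)\<close> and apply \<open>R m\<close>.\<close>
  have resolvent: "R l v = R m v + (l - m) *\<^sub>C R m (R l v)" if v: "v \<in> X" for l m v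
  proof -
    obtain a where a: "p a (y - l *\<^sub>C x) = v" by (rule orbit_onto[OF z(1) z(2) v])
    have Rl: "R l v = p a x" using R a by blast
    have "v = p a (y - m *\<^sub>C x) + (m - l) *\<^sub>C p a x"
      using x y a[symmetric] by (simp add: algebra_simps complex_vector.scale_left_diff_distrib)
    then have "R m v = R m (p a (y - m *\<^sub>C x)) + (m - l) *\<^sub>C R m (p a x)"
      using R_add[of "p a (y - m *\<^sub>C x)" "(m - l) *\<^sub>C p a x" m] R_scale[of "p a x" "p a x" m "m - l"] x z
      by (simp del: act_diff)
    then show ?thesis
      using R[of m a] Rl by (simp add: complex_vector.scale_left_diff_distrib)
  qed
  \<comment> \<open>A bound for \<open>R m\<close> yields twice that bound for \<open>R l\<close> with \<open>l\<close> close to \<open>m\<close>: the resolvent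
    identity expresses \<open>R l v\<close> by itself, with a factor that is at most one half.\<close>
  have local: "\<exists>B>0. \<exists>e>0. (\<forall>l v. v \<in> X \<longrightarrow> dist l m < e \<longrightarrow> norm (R l v) \<le> 2 * B * norm v)
        \<and> (\<forall>v\<in>X. norm (R m v) \<le> B * norm v)" for m
  proof -
    obtain B where B: "B > 0" "\<And>v. v \<in> X \<Longrightarrow> norm (R m v) \<le> B * norm v" using R_bound by blast
    have "norm (R l v) \<le> 2 * B * norm v" if v: "v \<in> X" and l: "dist l m < 1 / (2 * B)" for l v
    proof -
      have "norm (R l v) \<le> norm (R m v) + norm (l - m) * norm (R m (R l v))"
        using resolvent[OF v, of l m] norm_triangle_ineq[of "R m v" "(l - m) *\<^sub>C R m (R l v)"]
        by (simp add: norm_scaleC)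
      also have "\<dots> \<le> B * norm v + (1 / (2 * B)) * (B * norm (R l v))"
        using l B v by (intro add_mono mult_mono) (auto simp: dist_norm)
      also have "\<dots> = B * norm v + norm (R l v) / 2" using B by simp
      finally show ?thesis by simp
    qed
    then show ?thesis using B by (intro exI[of _ B] conjI exI[of _ "1 / (2 * B)"]) auto
  qed
  have lip: "norm (R l v - R m v) \<le> norm (l - m) * (B * (2 * B * norm v))"
    if v: "v \<in> X" and B: "B > 0" "\<And>v. v \<in> X \<Longrightarrow> norm (R l v) \<le> 2 * B * norm v"
       "\<And>v. v \<in> X \<Longrightarrow> norm (R m v) \<le> B * norm v" for l m v B
  proof -
    have "norm (R l v - R m v) = norm (l - m) * norm (R m (R l v))"
      using resolvent[OF v, of l m] by (metis add_diff_cancel_left' norm_scaleC)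
    also have "norm (R m (R l v)) \<le> B * norm (R l v)" by (rule B) simp
    also have "norm (R l v) \<le> 2 * B * norm v" by (rule B) fact
    finally show ?thesis using B(1) by (simp add: mult_left_mono)
  qed
  have "R 0 x = 0"
  proof (rule liouville_vector[where f = "\<lambda>l. R l x" and f' = "\<lambda>l. R l (R l x)"])
    fix m
    obtain B e where B: "B > 0" "e > 0" "\<And>l v. v \<in> X \<Longrightarrow> dist l m < e \<Longrightarrow> norm (R l v) \<le> 2 * B * norm v"
      "\<And>v. v \<in> X \<Longrightarrow> norm (R m v) \<le> B * norm v" using local[of m] by blast
    show "((\<lambda>l. R l x) has_derivative (\<lambda>h. h *\<^sub>C R m (R m x))) (at m)"
    proof (rule has_derivativeI_sandwich[OF B(2)])
      show "bounded_linear (\<lambda>h. h *\<^sub>C R m (R m x))" by (rule scaleC.bounded_linear_left)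
      have "((\<lambda>l. B * (norm (l - m) * (B * (2 * B * norm x)))) \<longlongrightarrow> B * (norm (m - m) * (B * (2 * B * norm x)))) (at m)"
        by (intro tendsto_intros)
      then show "((\<lambda>l. B * (norm (l - m) * (B * (2 * B * norm x)))) \<longlongrightarrow> 0) (at m)" by simp
      fix l assume l: "l \<noteq> m" "dist l m < e"
      have "R l x - R m x - (l - m) *\<^sub>C R m (R m x)
          = (l - m) *\<^sub>C R m (R l x) - (l - m) *\<^sub>C R m (R m x)"
        using resolvent[OF x(1), of l m] by (metis add_diff_cancel_left')
      also have "\<dots> = (l - m) *\<^sub>C R m (R l x - R m x)"
        by (simp only: R_diff[OF R_in R_in] complex_vector.scale_right_diff_distrib)
      finally have diff: "R l x - R m x - (l - m) *\<^sub>C R m (R m x) = (l - m) *\<^sub>C R m (R l x - R m x)" .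
      have "norm (R l x - R m x - (l - m) *\<^sub>C R m (R m x)) / norm (l - m) = norm (R m (R l x - R m x))"
        unfolding diff using l by (simp add: norm_scaleC)
      also have "\<dots> \<le> B * norm (R l x - R m x)" by (rule B) simp
      also have "\<dots> \<le> B * (norm (l - m) * (B * (2 * B * norm x)))"
        using lip[OF x(1) B(1), of l m] B l by (intro mult_left_mono) auto
      finally show "norm (R l x - R m x - (l - m) *\<^sub>C R m (R m x)) / norm (l - m)
        \<le> B * (norm (l - m) * (B * (2 * B * norm x)))" .
    qed
  next
    show "continuous_on UNIV (\<lambda>l. R l (R l x))"
    proof (rule continuous_at_imp_continuous_on, rule ballI)
      fix m
      obtain B e where B: "B > 0" "e > 0" "\<And>l v. v \<in> X \<Longrightarrow> dist l m < e \<Longrightarrow> norm (R l v) \<le> 2 * B * norm v"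
        "\<And>v. v \<in> X \<Longrightarrow> norm (R m v) \<le> B * norm v" using local[of m] by blast
      show "isCont (\<lambda>l. R l (R l x)) m"
      proof (rule isCont_of_Lipschitz_bound[OF B(2)])
        fix l assume l: "dist l m < e"
        have "norm (R l (R l x) - R m (R m x)) \<le> norm (R l (R l x - R m x)) + norm (R l (R m x) - R m (R m x))"
          using norm_triangle_ineq[of "R l (R l x - R m x)" "R l (R m x) - R m (R m x)"]
          by (simp add: R_diff)
        also have "\<dots> \<le> 2 * B * norm (R l x - R m x) + norm (l - m) * (B * (2 * B * norm (R m x)))"
          using B l by (intro add_mono lip) auto
        also have "\<dots> \<le> 2 * B * (norm (l - m) * (B * (2 * B * norm x))) + norm (l - m) * (B * (2 * B * norm (R m x)))"
          using B l x by (intro add_mono mult_left_mono lip) auto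
        finally show "dist (R l (R l x)) (R m (R m x))
            \<le> (2 * B * (B * (2 * B * norm x)) + B * (2 * B * norm (R m x))) * dist l m"
          by (simp add: dist_norm algebra_simps)
      qed
    qed
  next
    obtain C where C: "C \<ge> 0" "\<And>v. v \<in> X \<Longrightarrow> \<exists>a. p a x = v \<and> norm a \<le> C * norm v"
      using orbit_onto_bounded[OF x] by blast
    obtain M where M: "M \<ge> 0" "\<And>a x. x \<in> X \<Longrightarrow> norm (p a x) \<le> M * norm a * norm x"
      using act_bound by auto
    define D where "D = M * C * norm y"
    have D: "norm (p a y) \<le> D * norm (p a x)" for a
    proof -
      obtain b where b: "p b x = p a x" "norm b \<le> C * norm (p a x)" using C x by (meson act_in)
      then have "p (a - b) x = 0" using x by simp
      then have "p (a - b) y = 0" by (rule ann)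
      then have "norm (p a y) = norm (p b y)" using y by simp
      also have "\<dots> \<le> M * norm b * norm y" using M y by blast
      also have "\<dots> \<le> M * (C * norm (p a x)) * norm y"
        using b M by (intro mult_right_mono mult_left_mono) auto
      finally show ?thesis by (simp add: D_def mult_ac)
    qed
    \<comment> \<open>\<open>R l x = p a x\<close> with \<open>p a y - l (p a x) = x\<close>, and \<open>D\<close> bounds the norm of \<open>T\<close>.\<close>
    have decay: "norm (R l x) \<le> norm x / (norm l - D)" if l: "norm l > D" for l
    proof -
      obtain a where a: "p a (y - l *\<^sub>C x) = x" by (rule orbit_onto[OF z(1) z(2) x(1)])
      have "norm l * norm (p a x) = norm (p a y - x)"
        using a x y by (simp add: norm_scaleC[symmetric] algebra_simps)
      also have "\<dots> \<le> D * norm (p a x) + norm x"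
        using D[of a] norm_triangle_ineq4[of "p a y" x] by linarith
      finally have "norm (p a x) * (norm l - D) \<le> norm x" by (simp add: algebra_simps)
      moreover have "R l x = p a x" using R[of l a] a by simp
      ultimately show ?thesis using l by (simp add: pos_le_divide_eq)
    qed
    show "((\<lambda>l. R l x) \<longlongrightarrow> 0) at_infinity"
      unfolding tendsto_iff eventually_at_infinity
    proof (intro allI impI)
      fix e :: real assume e: "e > 0"
      show "\<exists>b. \<forall>l. b \<le> norm l \<longrightarrow> dist (R l x) 0 < e"
      proof (intro exI[of _ "D + norm x / e + 1"] allI impI)
        fix l :: complex assume l: "D + norm x / e + 1 \<le> norm l"
        have "norm x / e \<ge> 0" using e by simp
        then have lD: "norm l > D" using l by linarith
        have "norm x / e < norm l - D" using l by linarith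
        then have "norm x / (norm l - D) < e"
          using e lD by (simp add: field_simps)
        then show "dist (R l x) 0 < e" using decay[OF lD] by simp
      qed
    qed
  qed
  moreover obtain a where "p a y = x" using orbit_onto[OF z(1)[of 0] z(2)[of 0] x(1)] by auto
  ultimately have "p a x = 0" using R[of 0 a] by simp
  then have "p a y = 0" by (rule ann)
  then show False using \<open>p a y = x\<close> x by simp
qed

text \<open>
  The case of two vectors of Jacobson's density theorem.  Elements that kill one of the vectors
  but not the other exist by the previous theorem; multiplied from the left they reach every
  value, and two of them are added.
\<close>

theorem density_pair:
  assumes x: "x \<in> X" and y: "y \<in> X" and indep: "\<And>c. y \<noteq> c *\<^sub>C x" "\<And>c. x \<noteq> c *\<^sub>C y"
    and v: "v \<in> X" "w \<in> X"
  obtains a where "p a x = v" "p a y = w"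
proof -
  have "x \<noteq> 0" using indep(2)[of 0] by (auto simp: scaleC.zero_left)
  have "y \<noteq> 0" using indep(1)[of 0] by (auto simp: scaleC.zero_left)
  obtain b where b: "p b x = 0" "p b y \<noteq> 0"
    using commutant_scalar[OF x \<open>x \<noteq> 0\<close> y] indep by blast
  obtain c where c: "p c y = 0" "p c x \<noteq> 0"
    using commutant_scalar[OF y \<open>y \<noteq> 0\<close> x] indep by blast
  obtain b' where b': "p b' (p b y) = w" using orbit_onto[OF _ b(2) v(2)] y by auto
  obtain c' where c': "p c' (p c x) = v" using orbit_onto[OF _ c(2) v(1)] x by auto
  show thesis
    by (rule that[of "b' * b + c' * c"]) (use x y b b' c c' in auto)
qed

end

section \<open>Spectrum, quasinilpotent elements and the radical\<close>

text \<open>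
  Away from 0 the spectrum is described by a quasi-inverse inside the algebra: \<open>b\<close> is \<open>x\<close> times
  the inverse of \<open>x - z\<close>.  This treats algebras with and without identity alike.
\<close>

lemma notin_spectrumD:
  fixes x :: "'a::complex_banach_algebra"
  assumes "z \<notin> spectrum x" "z \<noteq> 0"
  obtains b where "b * x - z *\<^sub>C b = x" "x * b - z *\<^sub>C b = x"
proof (cases "\<exists>e::'a. is_identity e")
  case True
  then obtain e c where e: "\<And>y. e * y = y" "\<And>y. y * e = y"
    and c: "(x - z *\<^sub>C e) * c = e" "c * (x - z *\<^sub>C e) = e"
    using assms unfolding spectrum_def is_identity_def by auto
  have 1: "x * c = e + z *\<^sub>C c" "c * x = e + z *\<^sub>C c"
    using c e by (simp_all add: algebra_simps mult_scaleC_left mult_scaleC_right)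
  show thesis
  proof (rule that[of "x * c"])
    show "x * c * x - z *\<^sub>C (x * c) = x"
      using c(2) e by (simp add: mult.assoc 1(2) algebra_simps mult_scaleC_left mult_scaleC_right)
    have "x * (x * c) - z *\<^sub>C (x * c) = x * (c * x) - z *\<^sub>C (x * c)" by (simp only: 1)
    also have "\<dots> = x" using e by (simp add: 1 algebra_simps mult_scaleC_right)
    finally show "x * (x * c) - z *\<^sub>C (x * c) = x" .
  qed
next
  case False
  then obtain v where v: "unitization_mult (x, - z) v = (0, 1)" "unitization_mult v (x, - z) = (0, 1)"
    using assms(1) unfolding spectrum_def if_not_P[OF False] by blast
  obtain b s where bs: "v = (b, s)" by fastforce
  from v have s: "- z * s = 1" and
    1: "x * b + s *\<^sub>C x + (- z) *\<^sub>C b = 0" "b * x + (- z) *\<^sub>C b + s *\<^sub>C x = 0"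
    by (auto simp: unitization_mult_def bs)
  have zs: "z * s = - 1" using s by (metis add.inverse_inverse mult_minus_left)
  have 2: "z *\<^sub>C (x * b + s *\<^sub>C x + (- z) *\<^sub>C b) = 0" "z *\<^sub>C (b * x + (- z) *\<^sub>C b + s *\<^sub>C x) = 0"
    by (simp_all only: 1 complex_vector.scale_zero_right)
  show thesis
    by (rule that[of "z *\<^sub>C b"])
      (use 2 zs in \<open>simp_all add: scaleC_add_right mult_scaleC_left mult_scaleC_right
          complex_vector.scale_right_diff_distrib algebra_simps\<close>)
qed

lemma notin_spectrumI:
  fixes x :: "'a::complex_banach_algebra"
  assumes z: "z \<noteq> 0" and b: "b * x - z *\<^sub>C b = x" "x * b - z *\<^sub>C b = x"
  shows "z \<notin> spectrum x"
proof (cases "\<exists>e::'a. is_identity e")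
  case True
  then obtain e :: 'a where e: "is_identity e" "\<And>y. e * y = y" "\<And>y. y * e = y"
    by (auto simp: is_identity_def)
  let ?c = "(1 / z) *\<^sub>C (b - e)"
  have "(x - z *\<^sub>C e) * (b - e) = z *\<^sub>C e" "(b - e) * (x - z *\<^sub>C e) = z *\<^sub>C e"
    using b e by (simp_all add: algebra_simps mult_scaleC_left mult_scaleC_right)
  then have "(x - z *\<^sub>C e) * ?c = e \<and> ?c * (x - z *\<^sub>C e) = e"
    using z by (simp add: mult_scaleC_left mult_scaleC_right)
  then show ?thesis using True e(1) unfolding spectrum_def by auto
next
  case False
  have "unitization_mult (x, - z) ((1 / z) *\<^sub>C b, - 1 / z) = (0, 1)"
    "unitization_mult ((1 / z) *\<^sub>C b, - 1 / z) (x, - z) = (0, 1)"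
  proof -
    have "(1 / z) *\<^sub>C (x * b - z *\<^sub>C b) = (1 / z) *\<^sub>C x" "(1 / z) *\<^sub>C (b * x - z *\<^sub>C b) = (1 / z) *\<^sub>C x"
      using b by simp_all
    then show "unitization_mult (x, - z) ((1 / z) *\<^sub>C b, - 1 / z) = (0, 1)"
    "unitization_mult ((1 / z) *\<^sub>C b, - 1 / z) (x, - z) = (0, 1)"
      using z by (auto simp: unitization_mult_def mult_scaleC_left mult_scaleC_right
        complex_vector.scale_right_diff_distrib algebra_simps)
  qed
  then show ?thesis using False unfolding spectrum_def by auto
qed

lemma spectrum_zeroI:
  fixes x :: "'a::complex_banach_algebra"
  assumes "\<And>e. is_identity e \<Longrightarrow> \<nexists>c. c * x = e \<and> x * c = e"
  shows "0 \<in> spectrum x"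
  using assms unfolding spectrum_def
  by (auto simp: unitization_mult_def complex_vector.scale_zero_left)

text \<open>
  The quasi-inverse is \<open>- q / z\<close>.  The zero algebra has to be excluded, because the spectrum of
  its only element is empty.
\<close>

lemma square_zero_quasinilpotent:
  fixes q :: "'a::complex_banach_algebra"
  assumes q: "q * q = 0" and nontriv: "(y::'a) \<noteq> 0"
  shows "q \<in> quasinilpotents"
proof -
  have "z \<notin> spectrum q" if z: "z \<noteq> 0" for z
    by (rule notin_spectrumI[OF z, of "(- 1 / z) *\<^sub>C q"])
      (use z q in \<open>simp_all add: mult_scaleC_left mult_scaleC_right\<close>)
  moreover have "0 \<in> spectrum q"
  proof (rule spectrum_zeroI, rule notI, elim exE conjE)
    fix e c assume e: "is_identity e" "c * q = e" "q * c = e"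
    have "e = q * (c * e)" using e by (metis is_identity_def)
    also have "\<dots> = q * (c * (q * c))" by (simp only: e)
    also have "\<dots> = (q * (c * q)) * c" by (simp only: mult.assoc)
    also have "\<dots> = (q * e) * c" by (simp only: e)
    finally have "e = q * c" using e by (metis is_identity_def)
    have "q = q * (q * c)" using e by (metis is_identity_def)
    then have "q = 0" using q by (metis mult.assoc mult_zero_left)
    then have "e = 0" using e by simp
    then show False using nontriv e by (metis is_identity_def mult_zero_left)
  qed
  ultimately show ?thesis unfolding quasinilpotents_def by auto
qed

text \<open>
  An ideal that contains \<open>J\<close> is proper exactly if it avoids the right modular unit \<open>u\<close>, and this
  condition passes to unions of chains.
\<close>

lemma maximal_modular_left_ideal_avoiding:
  fixes u :: "'a::complex_banach_algebra"
  assumes J: "left_ideal J" "\<And>a. a - a * u \<in> J" "u \<notin> J"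
  obtains L where "maximal_modular_left_ideal L" "u \<notin> L"
proof -
  let ?A = "{L. left_ideal L \<and> J \<subseteq> L \<and> u \<notin> L}"
  have "\<exists>L\<in>?A. \<forall>M\<in>?A. L \<subseteq> M \<longrightarrow> M = L"
  proof (rule subset_Zorn_nonempty)
    show "?A \<noteq> {}" using J by blast
    fix C assume C: "C \<noteq> {}" "subset.chain ?A C"
    then have CA: "\<And>L. L \<in> C \<Longrightarrow> left_ideal L \<and> J \<subseteq> L \<and> u \<notin> L"
      and tot: "\<And>L M. L \<in> C \<Longrightarrow> M \<in> C \<Longrightarrow> L \<subseteq> M \<or> M \<subseteq> L"
      unfolding subset_chain_def by blast+
    have "left_ideal (\<Union>C)"
      unfolding left_ideal_def complex_vector.subspace_def
    proof (intro conjI ballI allI)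
      show "0 \<in> \<Union>C" using C(1) CA unfolding left_ideal_def complex_vector.subspace_def by blast
    next
      fix x y assume "x \<in> \<Union>C" "y \<in> \<Union>C"
      then obtain L where "L \<in> C" "x \<in> L" "y \<in> L" using tot by blast
      then show "x + y \<in> \<Union>C" using CA unfolding left_ideal_def complex_vector.subspace_def by blast
    next
      fix c x assume "x \<in> \<Union>C"
      then show "c *\<^sub>C x \<in> \<Union>C" using CA unfolding left_ideal_def complex_vector.subspace_def by blast
    next
      fix a x assume "x \<in> \<Union>C"
      then show "a * x \<in> \<Union>C" using CA unfolding left_ideal_def by blast
    qed
    then show "\<Union>C \<in> ?A" using C CA by blast
  qed
  then obtain L where L: "left_ideal L" "J \<subseteq> L" "u \<notin> L"
    and max: "\<And>M. left_ideal M \<Longrightarrow> J \<subseteq> M \<Longrightarrow> u \<notin> M \<Longrightarrow> L \<subseteq> M \<Longrightarrow> M = L"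
    by auto
  have "maximal_modular_left_ideal L"
    unfolding maximal_modular_left_ideal_def modular_left_ideal_def
  proof (intro conjI allI impI)
    show "\<exists>u. \<forall>a. a - a * u \<in> L" using J(2) L(2) by blast
    fix M assume M: "left_ideal M \<and> L \<subseteq> M"
    show "M = L \<or> M = UNIV"
    proof (cases "u \<in> M")
      case True
      have "a \<in> M" for a
      proof -
        have "a * u \<in> M" "a - a * u \<in> M"
          using M True J(2) L(2) unfolding left_ideal_def by blast+
        then have "(a - a * u) + a * u \<in> M"
          using M unfolding left_ideal_def by (blast intro: complex_vector.subspace_add)
        then show ?thesis by simp
      qed
      then show ?thesis by auto
    qed (use M L max in auto)
  qed (use L in auto)
  then show thesis using that L by blast
qed

lemma left_ideal_radical: "left_ideal jacobson_radical"
  unfolding jacobson_radical_def left_ideal_def complex_vector.subspace_def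
    maximal_modular_left_ideal_def modular_left_ideal_def left_ideal_def
  by auto

text \<open>
  The left ideal of all \<open>c y - c\<close> is modular with unit \<open>y\<close>.  If it did not contain \<open>y\<close>, a maximal
  modular left ideal would avoid \<open>y\<close>.
\<close>

lemma radical_left_quasi_inverse:
  assumes "y \<in> jacobson_radical"
  obtains b where "b * y - b = y"
proof -
  let ?J = "range (\<lambda>c. c * y - c)"
  have J: "left_ideal ?J"
    unfolding left_ideal_def complex_vector.subspace_def
  proof (intro conjI ballI allI)
    show "0 \<in> ?J" by (rule image_eqI[of _ _ 0]) auto
  next
    fix u v assume "u \<in> ?J" "v \<in> ?J"
    then obtain a b where "u = a * y - a" "v = b * y - b" by blast
    then show "u + v \<in> ?J" by (intro image_eqI[of _ _ "a + b"]) (auto simp: algebra_simps)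
  next
    fix c v assume "v \<in> ?J"
    then obtain a where "v = a * y - a" by blast
    then show "c *\<^sub>C v \<in> ?J"
      by (intro image_eqI[of _ _ "c *\<^sub>C a"]) (auto simp: complex_vector.scale_right_diff_distrib mult_scaleC_left)
  next
    fix c v assume "v \<in> ?J"
    then obtain a where "v = a * y - a" by blast
    then show "c * v \<in> ?J" by (intro image_eqI[of _ _ "c * a"]) (auto simp: right_diff_distrib mult.assoc)
  qed
  have "y \<in> ?J"
  proof (rule ccontr)
    assume "y \<notin> ?J"
    moreover have "a - a * y \<in> ?J" for a by (rule image_eqI[of _ _ "- a"]) auto
    ultimately obtain L where "maximal_modular_left_ideal L" "y \<notin> L"
      using maximal_modular_left_ideal_avoiding[OF J] by blast
    then show False using assms unfolding jacobson_radical_def by blast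
  qed
  then obtain b where "y = b * y - b" by blast
  then show thesis using that[of b] by simp
qed

text \<open>
  A left quasi-inverse \<open>b\<close> of \<open>y\<close> lies in the radical, so it has a left quasi-inverse \<open>c\<close> itself, and
  associativity forces \<open>c = y\<close>.
\<close>

lemma radical_quasi_inverse:
  fixes y :: "'a::complex_banach_algebra"
  assumes y: "y \<in> jacobson_radical"
  obtains b where "b * y - b = y" "y * b - b = y"
proof -
  obtain b where b: "b * y - b = y" using radical_left_quasi_inverse[OF y] by blast
  have "b * y - y \<in> jacobson_radical"
    using y left_ideal_radical unfolding left_ideal_def by (blast intro: complex_vector.subspace_diff)
  moreover have "b * y - y = b" using b by (simp add: algebra_simps)
  ultimately have "b \<in> jacobson_radical" by simp
  then obtain c where c: "c * b - c = b" using radical_left_quasi_inverse by blast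
  have by_eq: "b * y = b + y" and cb: "c * b = b + c" using b c by (simp_all add: algebra_simps)
  have "c * (b * y) = (c * b) * y" by (simp add: mult.assoc)
  then have "(b + c) + c * y = (b + y) + c * y" by (simp only: by_eq cb distrib_left distrib_right)
  then have "c = y" by simp
  have "y * b - b = y" using cb unfolding \<open>c = y\<close> by simp
  then show thesis using that b by blast
qed

text \<open>
  Multiples of \<open>x\<close> are quasi-invertible, which excludes nonzero spectrum.  If 0 were not in the
  spectrum, the identity would be in the radical, but it has no quasi-inverse.
\<close>

lemma radical_subset_quasinilpotents:
  fixes x y :: "'a::complex_banach_algebra"
  assumes x: "x \<in> jacobson_radical" and nontriv: "y \<noteq> 0"
  shows "x \<in> quasinilpotents"
proof -
  have rad: "c *\<^sub>C x \<in> jacobson_radical" "a * x \<in> jacobson_radical" for c a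
    using x left_ideal_radical unfolding left_ideal_def by (blast intro: complex_vector.subspace_scale)+
  have "z \<notin> spectrum x" if z: "z \<noteq> 0" for z
  proof -
    obtain b where "b * ((1 / z) *\<^sub>C x) - b = (1 / z) *\<^sub>C x" "((1 / z) *\<^sub>C x) * b - b = (1 / z) *\<^sub>C x"
      using radical_quasi_inverse rad by blast
    then have "z *\<^sub>C (b * ((1 / z) *\<^sub>C x) - b) = x" "z *\<^sub>C (((1 / z) *\<^sub>C x) * b - b) = x"
      using z by simp_all
    then show ?thesis using z
      by (intro notin_spectrumI[of z b])
        (simp_all add: mult_scaleC_left mult_scaleC_right complex_vector.scale_right_diff_distrib)
  qed
  moreover have "0 \<in> spectrum x"
  proof (rule spectrum_zeroI, rule notI, elim exE conjE)
    fix e c assume e: "is_identity e" "c * x = e" "x * c = e"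
    then have "e \<in> jacobson_radical" using rad by metis
    then obtain b where "b * e - b = e" using radical_quasi_inverse by blast
    then have "e = 0" using e by (simp add: is_identity_def)
    then show False using nontriv e by (metis is_identity_def mult_zero_left)
  qed
  ultimately show ?thesis unfolding quasinilpotents_def by auto
qed

section \<open>Derivations and representations of dimension at least two\<close>

lemma derivation_rules:
  assumes "derivation d"
  shows "d (a + b) = d a + d b" "d (c *\<^sub>C a) = c *\<^sub>C d a" "d (a * b) = d a * b + a * d b"
  using assms unfolding derivation_def
  by (auto simp: Vector_Spaces.linear_iff)

lemma derivation_zero: "derivation d \<Longrightarrow> d 0 = 0"
  using derivation_rules(1)[of d 0 0] by simp

lemma derivation_diff: "derivation d \<Longrightarrow> d (a - b) = d a - d b"
  using derivation_rules(1)[of d "a - b" b] by simp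

lemma derivation_scaleR: "derivation d \<Longrightarrow> d (r *\<^sub>R a) = r *\<^sub>R d a"
  using derivation_rules(2)[of d "of_real r" a] by (simp add: scaleC_of_real)

text \<open>
  With \<open>u = 1 + c\<close> the element \<open>1 + b\<close> is a left inverse of \<open>u\<close>.  It is found as the fixed point of a
  contraction, which needs no identity element.
\<close>

lemma quasi_inverse_small:
  fixes c :: "'a::complex_banach_algebra"
  assumes "norm c \<le> 1 / 2"
  obtains b where "b + c + b * c = 0" "norm b \<le> 2 * norm c"
proof -
  have "dist (- c - x * c) (- c - y * c) \<le> norm c * dist x y" for x y
    using norm_mult_ineq[of "x - y" c]
    by (simp add: dist_norm norm_minus_commute algebra_simps)
  then obtain b where b: "- c - b * c = b"
    using banach_fix_type[of "norm c" "\<lambda>b. - c - b * c"] assms by auto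
  have "b + c + b * c = b - (- c - b * c)" by simp
  then have 1: "b + c + b * c = 0" by (simp only: b diff_self)
  have "norm b \<le> norm c + norm (b * c)"
    using norm_triangle_ineq4[of "- c" "b * c"] b by simp
  also have "norm (b * c) \<le> norm b * (1 / 2)"
    using norm_mult_ineq[of b c] mult_left_mono[OF assms norm_ge_zero[of b]] by linarith
  finally have "norm b \<le> 2 * norm c" by simp
  with 1 show thesis by (rule that)
qed

lemma (in banach_representation) scaleR_in [simp]: "x \<in> X \<Longrightarrow> r *\<^sub>R x \<in> X"
  by (simp flip: scaleC_of_real)

lemma (in banach_representation) act_scaleR [simp]: "x \<in> X \<Longrightarrow> p a (r *\<^sub>R x) = r *\<^sub>R p a x"
  by (simp flip: scaleC_of_real)

text \<open>
  Apply \<open>b x - z b = x\<close>, where \<open>b\<close> is the quasi-inverse of \<open>x\<close> at \<open>z\<close>, to the vector \<open>v\<close>: the left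
  side vanishes and the right side is \<open>z v\<close>.
\<close>

lemma (in banach_representation) quasinilpotent_no_eigenvalue:
  assumes x: "x \<in> quasinilpotents" and v: "v \<in> X" "p x v = z *\<^sub>C v" and z: "z \<noteq> 0"
  shows "v = 0"
proof -
  have "z \<notin> spectrum x" using x z by (auto simp: quasinilpotents_def)
  then obtain b where b: "b * x - z *\<^sub>C b = x" using notin_spectrumD z by blast
  have "p (b * x - z *\<^sub>C b) v = 0" using v by simp
  then have "z *\<^sub>C v = 0" using b v by simp
  then show ?thesis using z by simp
qed

text \<open>
  The derivation may move the kernel of \<open>p\<close>, so that \<open>p (d a)\<close> is not determined by \<open>p a\<close>; the
  arguments therefore treat \<open>p\<close> and \<open>p \<circ> d\<close> as two maps linked by the Leibniz rule.  In the comments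
  on the following lemmas \<open>p\<close> is suppressed and elements of the algebra are written as operators on \<open>X\<close>.
\<close>

locale nilpotent_derivation = irreducible_banach_representation X p
  for X :: "'x::complex_banach set" and p :: "'a::complex_banach_algebra \<Rightarrow> 'x \<Rightarrow> 'x" +
  fixes d :: "'a \<Rightarrow> 'a"
  assumes d: "derivation d"
    and quasinilpotent: "\<And>q. q * q = 0 \<Longrightarrow> d q \<in> quasinilpotents"
begin

lemmas d_add = derivation_rules(1)[OF d]
  and d_mult = derivation_rules(3)[OF d]

text \<open>
  Let \<open>u = q v\<close> and \<open>y = (d q) u\<close>, which equals \<open>- q (d q) v\<close>.  If \<open>y\<close> is a nonzero multiple of \<open>u\<close>,
  then \<open>d q\<close> has a nonzero eigenvalue.  If \<open>u\<close> and \<open>y\<close> are independent, density provides \<open>a\<close> with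
  \<open>a u = v\<close> and \<open>a y = - v\<close>; the element \<open>n = q a q\<close> has square zero, and in
  \<open>d n = (d q) a q + q (d a) q + q a (d q)\<close> only the last term survives on \<open>u\<close>, so that \<open>- 1\<close> is an
  eigenvalue of \<open>d n\<close>.
\<close>

lemma d_annihilates_range:
  assumes q: "q * q = 0" and v: "v \<in> X"
  shows "p (d q) (p q v) = 0"
proof (rule ccontr)
  assume nz: "p (d q) (p q v) \<noteq> 0"
  define u where "u = p q v"
  define y where "y = p (d q) u"
  have qq: "p q (p q w) = 0" if "w \<in> X" for w
    using mult_act[OF that, of q q] q that by simp
  have anti: "p (d q) (p q w) + p q (p (d q) w) = 0" if "w \<in> X" for w
  proof -
    have "p (d (q * q)) w = 0" using q that derivation_zero[OF d] by simp
    then show ?thesis using that by (simp add: d_mult)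
  qed
  have X: "u \<in> X" "y \<in> X" using v by (simp_all add: u_def y_def)
  have y0: "y \<noteq> 0" using nz by (simp add: y_def u_def)
  have u0: "u \<noteq> 0" using y0 by (auto simp: y_def)
  show False
  proof (cases "\<exists>c. y = c *\<^sub>C u")
    case True
    then obtain c where "p (d q) u = c *\<^sub>C u" "c \<noteq> 0" using y0 y_def by (auto simp: scaleC.zero_left)
    then show False using quasinilpotent_no_eigenvalue[OF quasinilpotent[OF q] X(1)] u0 by blast
  next
    case False
    have "u \<noteq> c *\<^sub>C y" for c
    proof
      assume c: "u = c *\<^sub>C y"
      then have "c \<noteq> 0" using u0 by (auto simp: scaleC.zero_left)
      then have "y = (1 / c) *\<^sub>C u" using c by simp
      then show False using False by blast
    qed
    then obtain a where a: "p a u = v" "p a y = - v"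
      using density_pair[OF X, of v "- v"] False v diff_in[OF zero_in v] by auto
    define n where "n = q * a * q"
    have n: "n * n = 0"
    proof -
      have "n * n = q * a * (q * q) * a * q" by (simp add: n_def mult.assoc)
      then show ?thesis using q by simp
    qed
    have "d n = d q * a * q + q * d a * q + q * a * d q"
      by (simp add: n_def d_mult algebra_simps)
    then have "p (d n) u = p (d q) (p a (p q u)) + p q (p (d a) (p q u)) + p q (p a (p (d q) u))"
      using X by simp
    also have "\<dots> = p q (- v)"
      using qq[OF v] a v by (simp add: u_def[symmetric] y_def[symmetric])
    also have "\<dots> = (- 1) *\<^sub>C u" using act_diff[of 0 v q] v by (simp add: u_def)
    finally have "p (d n) u = (- 1) *\<^sub>C u" .
    then show False using quasinilpotent_no_eigenvalue[OF quasinilpotent[OF n] X(1)] u0 by fastforce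
  qed
qed

text \<open>
  Here \<open>1 + b\<close> is a left inverse of \<open>1 + c\<close>, so \<open>r = (1 + c) q (1 + b)\<close> has square zero.  Expanding
  \<open>(d r) r = 0\<close> with the Leibniz rule and \<open>(d q) q = 0\<close> leaves a single term, which after
  cancelling the outer factors is \<open>q (1 + b) (d c) q = 0\<close>.
\<close>

lemma d_conjugate:
  assumes q: "q * q = 0" and b: "b + c + b * c = 0" and v: "v \<in> X"
  shows "p q (p (d c) (p q v)) + p q (p b (p (d c) (p q v))) = 0"
proof -
  define w where "w = q + c * q"
  define r where "r = w + w * b"
  define e where "e = d c + b * d c"
  have bw: "w + b * w = q"
  proof -
    have "w + b * w = q + (b + c + b * c) * q" by (simp add: w_def algebra_simps)
    then show ?thesis by (simp add: b)
  qed
  have wq: "w * q = 0" using q by (simp add: w_def distrib_right mult.assoc)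
  have rw: "r * w = 0"
  proof -
    have "r * w = w * (w + b * w)" by (simp add: r_def algebra_simps)
    then show ?thesis by (simp add: bw wq)
  qed
  have r: "r * r = 0"
  proof -
    have "r * r = r * w + r * w * b" by (subst (2) r_def) (simp add: algebra_simps)
    then show ?thesis by (simp add: rw)
  qed
  have rc: "r + r * c = w"
  proof -
    have "r + r * c = w + w * (b + c + b * c)" by (simp add: r_def algebra_simps)
    then show ?thesis by (simp add: b)
  qed
  have "p (d r * w) v = 0"
  proof -
    have "p (d r) (p r (v + p c v)) = 0" using d_annihilates_range[OF r] v by (simp del: act_add)
    moreover have "p r (v + p c v) = p w v" using v by (simp flip: rc)
    ultimately show ?thesis using v by simp
  qed
  moreover have "d r * w = d q * q + c * (d q * q) - w * e * q"
  proof -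
    have dbc: "d b + d b * c = - e"
    proof -
      have "d (b + c + b * c) = 0" using derivation_zero[OF d] by (simp add: b)
      then have "(d b + d b * c) + e = 0" by (simp add: d_add d_mult e_def algebra_simps)
      then show ?thesis by (simp add: eq_neg_iff_add_eq_0)
    qed
    have "d r * w = d w * (w + b * w) + w * (d b * w)"
      by (simp add: r_def d_add d_mult algebra_simps)
    also have "d b * w = (d b + d b * c) * q" by (simp add: w_def algebra_simps)
    also have "\<dots> = - (e * q)" by (simp add: dbc)
    also have "d w * (w + b * w) = d w * q" by (simp only: bw)
    also have "\<dots> = d q * q + d c * (q * q) + c * (d q * q)"
      by (simp add: w_def d_add d_mult algebra_simps)
    finally show ?thesis using q by (simp add: mult.assoc)
  qed
  ultimately have "p (w * e * q) v = 0"
    using v d_annihilates_range[OF q v] by simp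
  then have "p (w * e * q) v + p b (p (w * e * q) v) = 0" by simp
  moreover have "q * e * q = w * e * q + b * (w * e * q)"
    by (subst bw[symmetric]) (simp add: algebra_simps)
  ultimately have "p (q * e * q) v = 0" using v by simp
  then show ?thesis using v by (simp add: e_def)
qed

text \<open>
  The elements \<open>b\<close> in the assumption are quasi-inverses of \<open>t a\<close>, hence of norm \<open>O(t)\<close>.  Letting \<open>t\<close>
  tend to 0 removes the second summand.
\<close>

lemma eq_0_if_perturbations_cancel:
  assumes z: "z \<in> X"
    and eq: "\<And>t b. t > 0 \<Longrightarrow> b + t *\<^sub>R a + b * (t *\<^sub>R a) = 0 \<Longrightarrow> p q z + p q (p b z) = 0"
  shows "p q z = 0"
proof -
  obtain M where M: "M \<ge> 0" "\<forall>a. \<forall>x\<in>X. norm (p a x) \<le> M * norm a * norm x"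
    using act_bound by blast
  define K where "K = M * norm q * (M * (2 * norm a) * norm z)"
  have bound: "norm (p q z) \<le> K * t" if t: "t > 0" "t * norm a \<le> 1 / 2" for t
  proof -
    obtain b where b: "b + t *\<^sub>R a + b * (t *\<^sub>R a) = 0" "norm b \<le> 2 * norm (t *\<^sub>R a)"
      using quasi_inverse_small[of "t *\<^sub>R a"] t by auto
    have "norm (p q z) = norm (p q (p b z))"
      using eq[OF t(1) b(1)] by (metis add_eq_0_iff norm_minus_cancel)
    also have "\<dots> \<le> M * norm q * norm (p b z)" using M z by simp
    also have "\<dots> \<le> M * norm q * (M * norm b * norm z)"
      using M z by (intro mult_left_mono) auto
    also have "\<dots> \<le> M * norm q * (M * (2 * norm (t *\<^sub>R a)) * norm z)"
      using M b by (intro mult_left_mono mult_right_mono) auto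
    finally show ?thesis using t by (simp add: K_def algebra_simps)
  qed
  have "((\<lambda>t. K * t) \<longlongrightarrow> K * 0) (at_right 0)" by (intro tendsto_intros)
  moreover have "\<forall>\<^sub>F t in at_right 0. norm (p q z) \<le> K * t"
  proof -
    have "((\<lambda>t. t * norm a) \<longlongrightarrow> 0 * norm a) (at_right 0)" by (intro tendsto_intros)
    then have "\<forall>\<^sub>F t in at_right 0. t * norm a < 1 / 2" by (rule order_tendstoD) simp
    then show ?thesis using eventually_at_right_less[of 0]
      by eventually_elim (auto intro: bound)
  qed
  ultimately have "norm (p q z) \<le> K * 0"
    by (intro tendsto_lowerbound[of "\<lambda>t. K * t" _ "at_right 0"]) auto
  then show ?thesis by simp
qed

text \<open>
  The conjugation identity with \<open>c = t a\<close>, divided by \<open>t\<close>, at its lowest order in \<open>t\<close>.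
\<close>

lemma d_between:
  assumes q: "q * q = 0" and v: "v \<in> X"
  shows "p q (p (d a) (p q v)) = 0"
proof (rule eq_0_if_perturbations_cancel[where a = a])
  fix t b assume t: "(t::real) > 0" and b: "b + t *\<^sub>R a + b * (t *\<^sub>R a) = 0"
  have "p q (p (t *\<^sub>R d a) (p q v)) + p q (p b (p (t *\<^sub>R d a) (p q v))) = 0"
    using d_conjugate[OF q b v] by (simp add: derivation_scaleR[OF d])
  then have "t *\<^sub>R (p q (p (d a) (p q v)) + p q (p b (p (d a) (p q v)))) = 0"
    using v by (simp add: scaleR_act scaleR_right_distrib)
  then show "p q (p (d a) (p q v)) + p q (p b (p (d a) (p q v))) = 0" using t by simp
qed (use v in simp)

text \<open>
  The next order of the same expansion: \<open>q b w = 0\<close> for \<open>w = (d a) q v\<close>, where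
  \<open>b = - t a - t b a\<close>, gives \<open>q a w + q b a w = 0\<close>.
\<close>

lemma d_between_square:
  assumes q: "q * q = 0" and v: "v \<in> X"
  shows "p q (p a (p (d a) (p q v))) = 0"
proof (rule eq_0_if_perturbations_cancel[where a = a])
  fix t b assume t: "(t::real) > 0" and b: "b + t *\<^sub>R a + b * (t *\<^sub>R a) = 0"
  define w where "w = p (d a) (p q v)"
  have w: "w \<in> X" "p q w = 0" using v d_between[OF q v] by (simp_all add: w_def)
  have "p q (t *\<^sub>R w) + p q (p b (t *\<^sub>R w)) = 0"
    using d_conjugate[OF q b v] v by (simp add: derivation_scaleR[OF d] scaleR_act w_def)
  then have "t *\<^sub>R p q (p b w) = 0"
    using w by simp
  then have "p q (p b w) = 0" using t by simp
  moreover have "p q (p (b + t *\<^sub>R a + b * (t *\<^sub>R a)) w) = 0" using b w by simp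
  ultimately have "t *\<^sub>R (p q (p a w) + p q (p b (p a w))) = 0"
    using w by (simp add: scaleR_act scaleR_right_distrib)
  then show "p q (p a (p (d a) (p q v))) + p q (p b (p a (p (d a) (p q v)))) = 0"
    using t by (simp add: w_def)
qed (use v in simp)

lemma d_between_polarized:
  assumes q: "q * q = 0" and v: "v \<in> X"
  shows "p q (p a (p (d b) (p q v))) + p q (p b (p (d a) (p q v))) = 0"
  using d_between_square[OF q v, of "a + b"] d_between_square[OF q v, of a]
    d_between_square[OF q v, of b] v
  by (simp add: d_add add_ac)

text \<open>
  Both sides are the negative of \<open>q a (d b) q v\<close>, the left one because \<open>q (d (a b)) q = 0\<close>, the right
  one by polarization.
\<close>

lemma d_between_commute:
  assumes q: "q * q = 0" and v: "v \<in> X"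
  shows "p q (p (d a) (p b (p q v))) = p q (p b (p (d a) (p q v)))"
proof -
  have "p q (p (d a) (p b (p q v))) + p q (p a (p (d b) (p q v))) = 0"
    using d_between[OF q v, of "a * b"] v by (simp add: d_mult)
  then show ?thesis using d_between_polarized[OF q v, of a b]
    by (metis add.commute add_left_cancel)
qed

text \<open>
  Let \<open>u = q v\<close>.  If \<open>(d a) u\<close> were independent of \<open>u\<close>, some \<open>b\<close> with \<open>b u = 0\<close> and \<open>b (d a) u = v\<close>
  would violate \<open>q (d a) b u = q b (d a) u\<close>.  So \<open>(d a) u = l(a) u\<close> for a scalar \<open>l(a)\<close>, and the
  polarized identity forces \<open>l = 0\<close>.  Then \<open>(d a) b u = d(a b) u - a (d b) u = 0\<close>, and the vectors
  \<open>b u\<close> exhaust \<open>X\<close>.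
\<close>

theorem derivation_into_kernel:
  assumes q: "q * q = 0" and v: "v \<in> X" "p q v \<noteq> 0" and x: "x \<in> X"
  shows "p (d a) x = 0"
proof -
  define u where "u = p q v"
  have u: "u \<in> X" "u \<noteq> 0" using v by (simp_all add: u_def)
  have "\<exists>c. p (d a) u = c *\<^sub>C u" for a
  proof (rule ccontr)
    assume no: "\<nexists>c. p (d a) u = c *\<^sub>C u"
    have "u \<noteq> c *\<^sub>C p (d a) u" for c
    proof
      assume c: "u = c *\<^sub>C p (d a) u"
      then have "c \<noteq> 0" using u by (auto simp: scaleC.zero_left)
      then have "p (d a) u = (1 / c) *\<^sub>C u" by (subst c) simp
      then show False using no by blast
    qed
    then obtain b where b: "p b u = 0" "p b (p (d a) u) = v"
      using density_pair[of u "p (d a) u" 0 v] no u v by auto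
    have "p q (p (d a) (p b u)) = p q (p b (p (d a) u))"
      unfolding u_def by (rule d_between_commute[OF q v(1)])
    then show False using b v by simp
  qed
  then obtain l where l: "\<And>a. p (d a) u = l a *\<^sub>C u" by metis
  have pol: "l b *\<^sub>C p q (p a u) + l a *\<^sub>C p q (p b u) = 0" for a b
    using d_between_polarized[OF q v(1), of a b] u by (simp flip: u_def add: l)
  have "l b = 0" for b
  proof (rule ccontr)
    assume lb: "l b \<noteq> 0"
    have "(2 * l b) *\<^sub>C p q (p b u) = 0"
      using pol[of b b] by (simp flip: complex_vector.scale_left_distrib)
    then have "p q (p b u) = 0" using lb by simp
    then have "p q (p a u) = 0" for a using pol[of b a] lb by (simp add: scaleC.zero_right)
    moreover obtain a where "p a u = v" by (rule orbit_onto[OF u v(1)])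
    ultimately show False using v by metis
  qed
  then have zero: "p (d a) u = 0" for a by (simp add: l scaleC.zero_left)
  obtain b where b: "p b u = x" by (rule orbit_onto[OF u x])
  have "p (d (a * b)) u = p (d a) (p b u) + p a (p (d b) u)" using u by (simp add: d_mult)
  then show ?thesis using zero b by simp
qed

end

section \<open>Derivations and characters\<close>

definition continuous_character :: "('a::complex_banach_algebra \<Rightarrow> complex) \<Rightarrow> bool" where
  "continuous_character f \<longleftrightarrow> bounded_linear f \<and> (\<forall>c a. f (c *\<^sub>C a) = c * f a)
     \<and> (\<forall>a b. f (a * b) = f a * f b) \<and> (\<exists>a. f a \<noteq> 0)"

lemma continuous_characterD:
  assumes "continuous_character f"
  shows "bounded_linear f" "f (c *\<^sub>C a) = c * f a" "f (a * b) = f a * f b"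
    "f (a + b) = f a + f b" "f (a - b) = f a - f b" "f 0 = 0" "f (r *\<^sub>R a) = r *\<^sub>R f a"
  using assms bounded_linear.axioms(1)[of f]
  unfolding continuous_character_def
  by (auto simp: linear_add linear_diff linear_0 linear_scale)

lemma character_unit:
  assumes "continuous_character f"
  obtains w where "f w = 1"
proof -
  obtain a where "f a \<noteq> 0" using assms by (auto simp: continuous_character_def)
  then show thesis
    using that[of "(1 / f a) *\<^sub>C a"] continuous_characterD(2)[OF assms] by simp
qed

text \<open>
  If \<open>f b = 1\<close> with \<open>b\<close> of norm less than 1, then the fixed point \<open>y\<close> of \<open>y \<mapsto> b + b y\<close> would satisfy
  \<open>f y = 1 + f y\<close>.
\<close>

lemma character_norm_le:
  fixes a :: "'a::complex_banach_algebra"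
  assumes f: "continuous_character f"
  shows "norm (f a) \<le> norm a"
proof (rule ccontr)
  assume *: "\<not> norm (f a) \<le> norm a"
  then have fa: "f a \<noteq> 0" by auto
  define b where "b = (1 / f a) *\<^sub>C a"
  have b: "f b = 1" using fa by (simp add: b_def continuous_characterD(2)[OF f])
  have nb: "norm b < 1" using * fa by (simp add: b_def norm_scaleC norm_divide divide_simps)
  have "dist (b + b * x) (b + b * y) \<le> norm b * dist x y" for x y
    using norm_mult_ineq[of b "x - y"] by (simp add: dist_norm right_diff_distrib)
  then obtain y where "b + b * y = y"
    using banach_fix_type[of "norm b" "\<lambda>y. b + b * y"] nb by auto
  then have "f y = f (b + b * y)" by simp
  also have "\<dots> = 1 + f y" using b by (simp add: continuous_characterD(3,4)[OF f])
  finally show False by simp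
qed

lemma bounded_linear_character_derivation:
  assumes f: "continuous_character f" and d: "derivation d"
    and K: "\<And>a. norm (f (d a)) \<le> K * norm a"
  shows "bounded_linear (\<lambda>a. f (d a))"
  by (rule bounded_linear_intro[where K = K])
    (use K in \<open>simp_all add: derivation_rules[OF d] derivation_scaleR[OF d] continuous_characterD[OF f] mult.commute\<close>)

text \<open>
  A substitute for continuity of the derivation induced on the quotient by the common kernel of
  \<open>F\<close>: the pairs \<open>(a, b)\<close> for which \<open>d a\<close> and \<open>b\<close> agree on \<open>F\<close> form a closed linear relation.
\<close>

lemma bounded_agreement:
  assumes "\<And>f. f \<in> F \<Longrightarrow> continuous_character f" "\<And>f. f \<in> F \<Longrightarrow> bounded_linear (\<lambda>a. f (d a))"
    and d: "derivation d"
  shows "\<exists>C\<ge>0. \<forall>a. \<exists>b. (\<forall>f\<in>F. f b = f (d a)) \<and> norm b \<le> C * norm (a :: 'a::complex_banach_algebra)"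
proof -
  let ?G = "{ab :: 'a \<times> 'a. \<forall>f\<in>F. f (snd ab) = f (d (fst ab))}"
  have "?G = (\<Inter>f\<in>F. {ab. f (snd ab) = f (d (fst ab))})" by auto
  moreover have "closed {ab. f (snd ab) = f (d (fst ab))}" if "f \<in> F" for f
  proof -
    note cont = bounded_linear.continuous_on[OF continuous_characterD(1)[OF assms(1)[OF that]]]
      bounded_linear.continuous_on[OF assms(2)[OF that]]
    show ?thesis by (intro closed_Collect_eq cont continuous_intros)
  qed
  ultimately have "closed ?G" by auto
  moreover have "subspace ?G"
    using assms(1) by (auto simp: subspace_def continuous_characterD derivation_rules[OF d]
        derivation_zero[OF d] derivation_scaleR[OF d])
  moreover have "fst ` ?G = UNIV" by (auto intro!: image_eqI[of x fst "(x, d x)" for x])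
  ultimately have "\<exists>C\<ge>0. \<forall>a\<in>UNIV. \<exists>b. (a, b) \<in> ?G \<and> norm b \<le> C * norm a"
    by (intro bounded_selection closed_UNIV)
  then show ?thesis by simp
qed

text \<open>
  The series of \<open>f \<circ> exp (t d)\<close> in the variable \<open>t\<close>, which makes sense as a formal power series
  although the exponential of a discontinuous derivation does not.
\<close>

definition taylor_series :: "('a::complex_banach_algebra \<Rightarrow> complex) \<Rightarrow> ('a \<Rightarrow> 'a) \<Rightarrow> 'a \<Rightarrow> complex fps" where
  "taylor_series f d a = Abs_fps (\<lambda>n. f ((d ^^ n) a) / fact n)"

text \<open>
  The Leibniz rule for all powers of \<open>d\<close> at once.  Since the formal derivative of the series of \<open>a\<close>
  is the series of \<open>d a\<close>, the coefficients of both sides satisfy the same recursion.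
\<close>

lemma taylor_series_mult:
  assumes f: "continuous_character f" and d: "derivation d"
  shows "taylor_series f d (a * b) = taylor_series f d a * taylor_series f d b"
proof -
  have deriv: "fps_deriv (taylor_series f d a) = taylor_series f d (d a)" for a
    by (rule fps_ext) (simp add: taylor_series_def funpow_swap1 field_simps del: of_nat_Suc)
  have add_pow: "(d ^^ n) (a + b) = (d ^^ n) a + (d ^^ n) b" for n a b
    by (induction n) (simp_all add: derivation_rules(1)[OF d])
  have add: "taylor_series f d (a + b) = taylor_series f d a + taylor_series f d b" for a b
    by (rule fps_ext) (simp add: taylor_series_def add_pow continuous_characterD(4)[OF f] add_divide_distrib)
  have "fps_nth (taylor_series f d (a * b)) n = fps_nth (taylor_series f d a * taylor_series f d b) n" for n
  proof (induction n arbitrary: a b)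
    case 0
    then show ?case by (simp add: taylor_series_def continuous_characterD(3)[OF f])
  next
    case (Suc n)
    have "of_nat (Suc n) * fps_nth (taylor_series f d (a * b)) (Suc n)
        = fps_nth (fps_deriv (taylor_series f d (a * b))) n"
      by simp
    also have "\<dots> = fps_nth (taylor_series f d (d a * b)) n + fps_nth (taylor_series f d (a * d b)) n"
      by (simp add: deriv derivation_rules(3)[OF d] add)
    also have "\<dots> = fps_nth (fps_deriv (taylor_series f d a * taylor_series f d b)) n"
      unfolding fps_deriv_mult deriv fps_add_nth Suc by (rule add.commute)
    also have "\<dots> = of_nat (Suc n) * fps_nth (taylor_series f d a * taylor_series f d b) (Suc n)"
      by (simp only: fps_deriv_nth Suc_eq_plus1)
    finally show ?case by (simp del: of_nat_Suc)
  qed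
  then show ?thesis by (rule fps_ext)
qed

text \<open>
  If \<open>f w = 1\<close>, then \<open>a w - (f a) w\<close> lies in the kernel of \<open>f\<close> and has the same image under \<open>f \<circ> d\<close>
  as \<open>a\<close>.
\<close>

lemma character_derivation_normalized:
  assumes f: "continuous_character f" and d: "derivation d" and a: "f (d a) \<noteq> 0"
  obtains x where "f x = 0" "f (d x) = 1"
proof -
  obtain w where w: "f w = 1" using character_unit[OF f] by blast
  let ?x = "(1 / f (d a)) *\<^sub>C (a * w - f a *\<^sub>C w)"
  show thesis
    by (rule that[of ?x])
      (use w a in \<open>simp_all add: continuous_characterD[OF f] derivation_rules[OF d] derivation_diff[OF d]\<close>)
qed

text \<open>
  The theorem of Singer and Wermer.  Suppose that \<open>f x = 0\<close> and \<open>f (d x) = 1\<close>.  Then the series of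
  \<open>x\<close> starts with \<open>t\<close>, so by multiplicativity \<open>f\<close> takes the value \<open>n!\<close> at the \<open>n\<close>-fold derivative of
  \<open>x\<close> to the power \<open>n\<close>.  On the other hand \<open>d\<close> is bounded modulo the common kernel of \<open>F\<close>, which it
  preserves, so this value is at most the \<open>n\<close>-th power of a constant.
\<close>

theorem bounded_character_derivation_eq_0:
  fixes d :: "'a::complex_banach_algebra \<Rightarrow> 'a"
  assumes char: "\<And>f. f \<in> F \<Longrightarrow> continuous_character f" and d: "derivation d"
    and inv: "\<And>a. \<forall>f\<in>F. f a = 0 \<Longrightarrow> \<forall>f\<in>F. f (d a) = 0"
    and bdd: "\<And>f. f \<in> F \<Longrightarrow> bounded_linear (\<lambda>a. f (d a))"
    and f: "f \<in> F"
  shows "f (d a) = 0"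
proof (rule ccontr)
  assume "f (d a) \<noteq> 0"
  then obtain x where x: "f x = 0" "f (d x) = 1"
    using character_derivation_normalized[OF char[OF f] d] by blast
  obtain C where C: "C \<ge> 0" "\<forall>a. \<exists>b. (\<forall>f\<in>F. f b = f (d a)) \<and> norm b \<le> C * norm a"
    using bounded_agreement[OF char bdd d] by blast
  have iter: "\<exists>b. (\<forall>f\<in>F. f b = f ((d ^^ n) a)) \<and> norm b \<le> C ^ n * norm a" for n a
  proof (induction n)
    case 0
    then show ?case by (intro exI[of _ a]) simp
  next
    case (Suc n)
    then obtain b where b: "\<forall>f\<in>F. f b = f ((d ^^ n) a)" "norm b \<le> C ^ n * norm a" by blast
    obtain b' where b': "\<forall>f\<in>F. f b' = f (d b)" "norm b' \<le> C * norm b" using C by blast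
    have "\<forall>g\<in>F. g ((d ^^ n) a - b) = 0"
      using b(1) by (auto simp: continuous_characterD(5)[OF char])
    from inv[OF this] have "\<forall>g\<in>F. g (d ((d ^^ n) a)) = g (d b)"
      by (simp add: continuous_characterD(5)[OF char] derivation_diff[OF d])
    then have "\<forall>g\<in>F. g b' = g ((d ^^ Suc n) a)" using b'(1) by auto
    moreover have "norm b' \<le> C ^ Suc n * norm a"
      using b'(2) mult_left_mono[OF b(2) C(1)] by (simp add: mult.assoc)
    ultimately show ?case by blast
  qed
  \<comment> \<open>Without an identity element powers start at the first one: \<open>pow n\<close> is \<open>x\<close> to the power \<open>n + 1\<close>.\<close>
  define pow where "pow n = ((\<lambda>y. x * y) ^^ n) x" for n
  have pow_norm: "norm (pow n) \<le> norm x ^ Suc n" for n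
  proof (induction n)
    case (Suc n)
    have "norm (pow (Suc n)) \<le> norm x * norm (pow n)" by (simp add: pow_def norm_mult_ineq)
    also have "\<dots> \<le> norm x * norm x ^ Suc n" by (intro mult_left_mono Suc) simp
    finally show ?case by simp
  qed (simp add: pow_def)
  have "taylor_series f d (pow n) = taylor_series f d x ^ Suc n" for n
    by (induction n) (simp_all add: pow_def taylor_series_mult[OF char[OF f] d])
  moreover have "fps_nth (taylor_series f d x ^ n) n = 1" for n
    using startsby_zero_power_nth_same[of "taylor_series f d x" n] x by (simp add: taylor_series_def)
  ultimately have "fps_nth (taylor_series f d (pow n)) (Suc n) = 1" for n by (simp only:)
  then have "f ((d ^^ Suc n) (pow n)) = fact (Suc n)" for n
    by (simp add: taylor_series_def del: fact_Suc funpow.simps)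
  then have fact: "norm (f ((d ^^ Suc n) (pow n))) = fact (Suc n)" for n
    by (simp only: norm_fact)
  have "fact (Suc n) \<le> (C * norm x) ^ Suc n" for n
  proof -
    obtain b where b: "\<forall>f\<in>F. f b = f ((d ^^ Suc n) (pow n))" "norm b \<le> C ^ Suc n * norm (pow n)"
      using iter by blast
    have "fact (Suc n) = norm (f b)" using b(1) f fact by metis
    also have "\<dots> \<le> norm b" by (rule character_norm_le[OF char[OF f]])
    also have "\<dots> \<le> C ^ Suc n * norm (pow n)" by (rule b)
    also have "\<dots> \<le> C ^ Suc n * norm x ^ Suc n" using C by (intro mult_left_mono pow_norm) auto
    finally show ?thesis by (simp only: power_mult_distrib)
  qed
  then have ge1: "1 \<le> (C * norm x) ^ Suc n / fact (Suc n)" for n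
    by (simp add: pos_le_divide_eq del: fact_Suc power_Suc)
  have "(\<lambda>n. (C * norm x) ^ n / fact n) \<longlonglongrightarrow> 0"
    using summable_LIMSEQ_zero[OF summable_exp[of "C * norm x"]] by (simp add: divide_inverse mult.commute)
  then have "(\<lambda>n. (C * norm x) ^ Suc n / fact (Suc n)) \<longlonglongrightarrow> 0"
    by (rule LIMSEQ_Suc)
  then have "(1::real) \<le> 0"
    by (rule LIMSEQ_le_const) (use ge1 in blast)
  then show False by simp
qed

text \<open>
  After scaling, \<open>s\<close> is modulo the common kernel of \<open>F\<close> an idempotent \<open>e\<close> with \<open>e a = (f a) e\<close>.
  Differentiating \<open>e e = e\<close> gives \<open>f (d e) = 0\<close>, and then differentiating the second relation gives
  \<open>f (d a) = 0\<close>.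
\<close>

lemma isolated_character_derivation_eq_0:
  assumes char: "\<And>f. f \<in> F \<Longrightarrow> continuous_character f" and d: "derivation d"
    and inv: "\<And>a. \<forall>f\<in>F. f a = 0 \<Longrightarrow> \<forall>f\<in>F. f (d a) = 0"
    and f: "f \<in> F" and s: "f s \<noteq> 0" "\<And>g. g \<in> F \<Longrightarrow> g \<noteq> f \<Longrightarrow> g s = 0"
  shows "f (d a) = 0"
proof -
  note ch = continuous_characterD[OF char]
  define e where "e = (1 / f s) *\<^sub>C s"
  have e: "f e = 1" "\<And>g. g \<in> F \<Longrightarrow> g \<noteq> f \<Longrightarrow> g e = 0"
    using s f by (simp_all add: e_def ch)
  have "\<forall>g\<in>F. g (e * e - e) = 0"
  proof
    fix g assume "g \<in> F"
    then show "g (e * e - e) = 0" using e by (cases "g = f") (simp_all add: ch)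
  qed
  from bspec[OF inv[OF this] f] have de: "f (d e) = 0"
    using f e by (simp add: ch derivation_diff[OF d] derivation_rules[OF d])
  have "\<forall>g\<in>F. g (e * a - f a *\<^sub>C e) = 0"
  proof
    fix g assume "g \<in> F"
    then show "g (e * a - f a *\<^sub>C e) = 0" using e by (cases "g = f") (simp_all add: ch)
  qed
  from bspec[OF inv[OF this] f] show ?thesis
    using f e de by (simp add: ch derivation_diff[OF d] derivation_rules[OF d])
qed

text \<open>
  To make \<open>t\<close> vanish at one more character \<open>g\<close>, replace it by \<open>a t - (g a) t\<close> where \<open>f a \<noteq> g a\<close>.
\<close>

lemma character_separation:
  assumes "finite F" and char: "\<And>g. g \<in> F \<Longrightarrow> continuous_character g" and f: "continuous_character f"
  shows "\<exists>t. f t \<noteq> 0 \<and> (\<forall>g\<in>F - {f}. g t = 0)"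
  using assms(1) char
proof (induction F)
  case empty
  show ?case using f by (auto simp: continuous_character_def)
next
  case (insert g F)
  then obtain t where t: "f t \<noteq> 0" "\<forall>g\<in>F - {f}. g t = 0" by auto
  show ?case
  proof (cases "g = f")
    case False
    have g: "continuous_character g" using insert by simp
    obtain a where a: "f a \<noteq> g a" using False by fastforce
    let ?t = "(a * t - g a *\<^sub>C t)"
    have "f ?t \<noteq> 0" using a t by (simp add: continuous_characterD[OF f] flip: left_diff_distrib)
    moreover have "g ?t = 0" by (simp add: continuous_characterD[OF g])
    moreover have "h ?t = 0" if "h \<in> F - {f}" for h
      using t that insert.prems by (simp add: continuous_characterD)
    ultimately show ?thesis by (intro exI[of _ ?t]) auto
  qed (use t in auto)
qed

text \<open>
  Let \<open>U\<close> be the finite set of characters in \<open>F\<close> at which \<open>d\<close> is unbounded and suppose \<open>f \<in> U\<close>.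
  Off \<open>U\<close>, \<open>d a\<close> agrees with some \<open>b\<close> of norm at most \<open>C\<close> times that of \<open>a\<close>; for a suitable \<open>a\<close> this is too
  small to agree at \<open>f\<close>.  Multiplying \<open>d a - b\<close> by an element that separates \<open>f\<close> from the rest of \<open>U\<close>
  isolates \<open>f\<close>, and at an isolated character \<open>d\<close> vanishes.
\<close>

lemma bounded_if_finitely_many_unbounded:
  fixes d :: "'a::complex_banach_algebra \<Rightarrow> 'a"
  assumes char: "\<And>f. f \<in> F \<Longrightarrow> continuous_character f" and d: "derivation d"
    and inv: "\<And>a. \<forall>f\<in>F. f a = 0 \<Longrightarrow> \<forall>f\<in>F. f (d a) = 0"
    and fin: "finite {f \<in> F. \<not> bounded_linear (\<lambda>a. f (d a))}"
    and f: "f \<in> F"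
  shows "bounded_linear (\<lambda>a. f (d a))"
proof (rule ccontr)
  define U where "U = {f \<in> F. \<not> bounded_linear (\<lambda>a. f (d a))}"
  assume nb: "\<not> bounded_linear (\<lambda>a. f (d a))"
  have "\<exists>C\<ge>0. \<forall>a. \<exists>b. (\<forall>g\<in>F - U. g b = g (d a)) \<and> norm b \<le> C * norm a"
    by (rule bounded_agreement) (use char d in \<open>auto simp: U_def\<close>)
  then obtain C where C: "\<forall>a. \<exists>b. (\<forall>g\<in>F - U. g b = g (d a)) \<and> norm b \<le> C * norm a"
    by blast
  obtain a where a: "norm (f (d a)) > C * norm a"
    using bounded_linear_character_derivation[OF char[OF f] d] nb by (meson not_less)
  obtain b where b: "\<And>g. g \<in> F - U \<Longrightarrow> g b = g (d a)" "norm b \<le> C * norm a" using C by blast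
  have "norm (f b) < norm (f (d a))"
    using character_norm_le[OF char[OF f], of b] b(2) a by linarith
  then have 1: "f (d a - b) \<noteq> 0" using f by (auto simp: continuous_characterD[OF char])
  obtain t where t: "f t \<noteq> 0" "\<And>g. g \<in> U - {f} \<Longrightarrow> g t = 0"
    using character_separation[of U f] fin char f unfolding U_def by auto
  have "f (d x) = 0" for x
  proof (rule isolated_character_derivation_eq_0[where F = F and f = f and d = d and s = "(d a - b) * t"])
    show "f ((d a - b) * t) \<noteq> 0" using 1 t f by (simp add: continuous_characterD(3)[OF char])
    show "g ((d a - b) * t) = 0" if "g \<in> F" "g \<noteq> f" for g
      using that t(2)[of g] b(1)[of g] by (cases "g \<in> U") (simp_all add: continuous_characterD[OF char])
  qed (use char d inv f in auto)
  then show False using nb by simp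
qed

text \<open>
  The product \<open>h n (h (n + 1) (... (h (n + j - 1) y)))\<close>, written as an operator on \<open>y\<close> because the
  algebra has no identity element to serve as the empty product.
\<close>

primrec nested_product :: "(nat \<Rightarrow> 'a::times) \<Rightarrow> nat \<Rightarrow> nat \<Rightarrow> 'a \<Rightarrow> 'a" where
  "nested_product h 0 n y = y"
| "nested_product h (Suc j) n y = h n * nested_product h j (Suc n) y"

lemma nested_product_snoc:
  "nested_product h j n (h (n + j) * y) = nested_product h (Suc j) n y"
proof (induction j arbitrary: n)
  case (Suc j)
  show ?case using Suc[of "Suc n"] by simp
qed simp

lemma nested_product_add:
  fixes h :: "nat \<Rightarrow> 'a::semiring"
  shows "nested_product h j n (x + y) = nested_product h j n x + nested_product h j n y"
  by (induction j arbitrary: n) (simp_all add: distrib_left)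

lemma norm_nested_product_le:
  fixes h :: "nat \<Rightarrow> 'a::real_normed_algebra"
  assumes "\<And>n. norm (h n) \<le> 1"
  shows "norm (nested_product h j n y) \<le> norm y"
proof (induction j arbitrary: n)
  case (Suc j)
  have "norm (nested_product h (Suc j) n y) \<le> norm (h n) * norm (nested_product h j (Suc n) y)"
    by (simp add: norm_mult_ineq)
  also have "\<dots> \<le> 1 * norm y" by (intro mult_mono assms Suc) auto
  finally show ?case by simp
qed simp

text \<open>
  The leading coefficient \<open>P\<close> is the product of the values \<open>f (h i)\<close>.
\<close>

lemma character_derivation_nested_product:
  assumes f: "continuous_character f" and d: "derivation d"
    and "\<And>i. n \<le> i \<Longrightarrow> i < n + j \<Longrightarrow> f (h i) \<noteq> 0"
  shows "\<exists>P R. P \<noteq> 0 \<and> (\<forall>y. f (nested_product h j n y) = P * f y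
           \<and> f (d (nested_product h j n y)) = P * f (d y) + R * f y)"
  using assms(3)
proof (induction j arbitrary: n)
  case 0
  show ?case by (intro exI[of _ 1] exI[of _ 0]) simp
next
  case (Suc j)
  then obtain P R where PR: "P \<noteq> 0" "\<And>y. f (nested_product h j (Suc n) y) = P * f y"
      "\<And>y. f (d (nested_product h j (Suc n) y)) = P * f (d y) + R * f y"
    by (metis (no_types, lifting) Suc_leD add_Suc_right add_Suc)
  show ?case
    by (intro exI[of _ "f (h n) * P"] exI[of _ "f (d (h n)) * P + f (h n) * R"])
      (use PR Suc.prems[of n] in \<open>simp add: continuous_characterD[OF f] derivation_rules[OF d] algebra_simps\<close>)
qed

text \<open>
  The functionals \<open>f n\<close> and the differences \<open>f m - f n\<close> are countably many and all nonzero.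
\<close>

lemma separating_element:
  fixes f :: "nat \<Rightarrow> 'a::complex_banach_algebra \<Rightarrow> complex"
  assumes char: "\<And>n. continuous_character (f n)" and inj: "inj f"
  obtains b where "\<And>n. f n b \<noteq> 0" "\<And>m n. m \<noteq> n \<Longrightarrow> f m b \<noteq> f n b"
proof -
  define g where "g k = (case prod_decode k of (m, n) \<Rightarrow> if m = n then f m else (\<lambda>x. f m x - f n x))" for k
  have "bounded_linear (g k)" for k
    using continuous_characterD(1)[OF char]
    by (auto simp: g_def intro: bounded_linear_sub split: prod.split)
  moreover have "\<exists>x. g k x \<noteq> 0" for k
  proof -
    obtain m n where mn: "prod_decode k = (m, n)" by fastforce
    show ?thesis
    proof (cases "m = n")
      case True
      then show ?thesis using char[of m] mn by (auto simp: g_def continuous_character_def)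
    next
      case False
      then have "f m \<noteq> f n" using inj by (auto dest: injD)
      then show ?thesis using mn False by (auto simp: g_def)
    qed
  qed
  ultimately obtain b where b: "\<And>k. g k b \<noteq> 0" using countable_common_nonzero[of g] by blast
  show thesis
  proof (rule that)
    show "f n b \<noteq> 0" for n using b[of "prod_encode (n, n)"] by (simp add: g_def)
    show "f m b \<noteq> f n b" if "m \<noteq> n" for m n
      using b[of "prod_encode (m, n)"] that by (simp add: g_def)
  qed
qed

text \<open>
  Johnson's gliding hump argument.  From infinitely many characters \<open>f n\<close> with \<open>f n \<circ> d\<close> unbounded,
  elements \<open>h n\<close> are constructed such that \<open>f n\<close> and \<open>f n \<circ> d\<close> vanish at \<open>h n\<close>, whereas no other
  \<open>f m\<close> does.  For the sum \<open>y\<close> of all \<open>h 0 ... h (n - 1) a n\<close>, all terms after the \<open>n\<close>-th contain the factor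
  \<open>h n\<close> and do not contribute to \<open>f n (d y)\<close>; unboundedness permits to choose \<open>a n\<close> small, but with
  the \<open>n\<close>-th term so large at \<open>f n \<circ> d\<close> that it dominates the earlier ones by \<open>n\<close>.  Since characters have norm at
  most 1, the norm of \<open>d y\<close> would exceed every \<open>n\<close>.
\<close>

theorem finite_unbounded_characters:
  fixes d :: "'a::complex_banach_algebra \<Rightarrow> 'a"
  assumes char: "\<And>f. f \<in> F \<Longrightarrow> continuous_character f" and d: "derivation d"
  shows "finite {f \<in> F. \<not> bounded_linear (\<lambda>a. f (d a))}"
proof (rule ccontr)
  assume "infinite {f \<in> F. \<not> bounded_linear (\<lambda>a. f (d a))}"
  then obtain f :: "nat \<Rightarrow> 'a \<Rightarrow> complex" where inj: "inj f"
    and f: "range f \<subseteq> {f \<in> F. \<not> bounded_linear (\<lambda>a. f (d a))}"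
    by (rule infinite_countable_subset[THEN exE]) blast
  have ch: "continuous_character (f n)" and nb: "\<not> bounded_linear (\<lambda>a. f n (d a))" for n
    using f char by auto
  note chD = continuous_characterD[OF ch]
  obtain b where b: "\<And>n. f n b \<noteq> 0" "\<And>m n. m \<noteq> n \<Longrightarrow> f m b \<noteq> f n b"
    using separating_element[OF ch inj] by blast
  \<comment> \<open>A polynomial in \<open>b\<close> that vanishes at \<open>f n\<close> only; squaring it also kills \<open>f n \<circ> d\<close>.\<close>
  define c where "c n = b * b - f n b *\<^sub>C b" for n
  define h where "h n = (1 / (1 + norm (c n * c n))) *\<^sub>R (c n * c n)" for n
  have c: "f m (c n) = f m b * (f m b - f n b)" for m n
    by (simp add: c_def chD algebra_simps)
  have pos: "1 + norm (c n * c n) > 0" for n by (simp add: add_pos_nonneg)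
  have h_norm: "norm (h n) \<le> 1" for n using pos[of n] by (simp add: h_def)
  have h_zero: "f n (h n) = 0" "f n (d (h n)) = 0" for n
    by (simp_all add: h_def chD derivation_scaleR[OF d] derivation_rules[OF d] c)
  have h_nonzero: "f m (h n) \<noteq> 0" if "m \<noteq> n" for m n
    using b that pos[of n] by (simp add: h_def chD c)
  have choice: "\<exists>a. norm a \<le> (1/2) ^ n \<and> norm (f n (d (nested_product h n 0 a))) \<ge> S" for n S
  proof (rule ccontr)
    assume "\<nexists>a. norm a \<le> (1/2) ^ n \<and> norm (f n (d (nested_product h n 0 a))) \<ge> S"
    then have S: "norm (f n (d (nested_product h n 0 a))) < S" if "norm a \<le> (1/2) ^ n" for a
      using that by force
    have S0: "S > 0" using S[of 0] by (simp add: order.strict_trans1[OF norm_ge_zero])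
    obtain P R where PR: "P \<noteq> 0" "\<And>y. f n (d (nested_product h n 0 y)) = P * f n (d y) + R * f n y"
      using character_derivation_nested_product[OF ch d, of 0 n n h] h_nonzero by (metis add_0 less_irrefl)
    have "norm (f n (d a)) \<le> ((S * 2 ^ n + norm R) / norm P) * norm a" for a
    proof (cases "a = 0")
      case True
      then show ?thesis by (simp add: derivation_zero[OF d] chD)
    next
      case False
      define r where "r = (1/2) ^ n / norm a"
      have r: "r > 0" using False by (simp add: r_def)
      have "norm (f n (d (nested_product h n 0 (r *\<^sub>R a)))) < S"
        by (rule S) (use False in \<open>simp add: r_def\<close>)
      then have "norm (r *\<^sub>R (P * f n (d a) + R * f n a)) < S"
        by (simp add: PR derivation_scaleR[OF d] chD scaleR_right_distrib)
      then have "norm (P * f n (d a) + R * f n a) * r < S"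
        using r by (simp only: norm_scaleR) (simp add: mult.commute)
      then have "norm (P * f n (d a) + R * f n a) \<le> S / r"
        using r by (simp add: pos_le_divide_eq)
      also have "S / r = S * 2 ^ n * norm a" by (simp add: r_def power_one_over)
      finally have "norm (P * f n (d a) + R * f n a) \<le> S * 2 ^ n * norm a" .
      moreover have "norm (R * f n a) \<le> norm R * norm a"
        using character_norm_le[OF ch] by (simp add: norm_mult mult_left_mono)
      ultimately have "norm (P * f n (d a)) \<le> S * 2 ^ n * norm a + norm R * norm a"
        using norm_triangle_ineq4[of "P * f n (d a) + R * f n a" "R * f n a"] by simp
      then show ?thesis using PR(1) by (simp add: norm_mult field_simps)
    qed
    then show False using bounded_linear_character_derivation[OF ch d] nb by blast
  qed
  have "\<forall>n s. \<exists>a. norm a \<le> (1/2) ^ n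
      \<and> real n + norm (f n (d s)) \<le> norm (f n (d (nested_product h n 0 a)))"
    using choice by blast
  then obtain A where A: "\<And>n s. norm (A n s) \<le> (1/2) ^ n"
    "\<And>n s. norm (f n (d (nested_product h n 0 (A n s)))) \<ge> real n + norm (f n (d s))"
    by metis
  \<comment> \<open>\<open>s n\<close> is the sum of the first \<open>n\<close> terms, on which the choice of the next one depends.
    The tails \<open>y n\<close> have the factors \<open>h 0, ..., h (n - 1)\<close> removed.\<close>
  define s where "s = rec_nat 0 (\<lambda>n s. s + nested_product h n 0 (A n s))"
  define a where "a n = A n (s n)" for n
  define y where "y n = (\<Sum>j. nested_product h j n (a (n + j)))" for n
  have sS: "s (Suc n) = s n + nested_product h n 0 (a n)" for n by (simp add: s_def a_def)
  have summ: "summable (\<lambda>j. nested_product h j n (a (n + j)))" for n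
  proof (rule summable_comparison_test)
    show "summable (\<lambda>j. (1/2::real) ^ n * (1/2) ^ j)" by (intro summable_mult summable_geometric) simp
    have "norm (nested_product h j n (a (n + j))) \<le> (1/2) ^ n * (1/2) ^ j" for j
      using order_trans[OF norm_nested_product_le[of h, OF h_norm] A(1)[of "n + j" "s (n + j)"]]
      by (simp add: a_def power_add)
    then show "\<exists>N. \<forall>j\<ge>N. norm (nested_product h j n (a (n + j))) \<le> (1/2) ^ n * (1/2) ^ j" by blast
  qed
  have yS: "y n = a n + h n * y (Suc n)" for n
    using suminf_split_head[OF summ[of n]] suminf_mult[OF summ[of "Suc n"], of "h n"]
    by (simp add: y_def algebra_simps)
  have y0: "y 0 = s n + nested_product h n 0 (y n)" for n
  proof (induction n)
    case (Suc n)
    have "nested_product h n 0 (y n) = nested_product h n 0 (a n) + nested_product h (Suc n) 0 (y (Suc n))"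
      using nested_product_snoc[of h n 0] by (subst yS) (simp only: nested_product_add add_0)
    then show ?case using Suc by (simp only: sS add.assoc)
  qed (simp add: s_def)
  have "real n \<le> norm (d (y 0))" for n
  proof -
    obtain P R where PR: "\<And>y. f n (d (nested_product h n 0 y)) = P * f n (d y) + R * f n y"
      using character_derivation_nested_product[OF ch d, of 0 n n h] h_nonzero by (metis add_0 less_irrefl)
    have "f n (d (nested_product h n 0 (h n * y (Suc n)))) = 0"
      by (simp add: PR chD derivation_rules[OF d] h_zero)
    then have "f n (d (y 0)) = f n (d (s n)) + f n (d (nested_product h n 0 (a n)))"
      by (subst y0[of n], subst yS) (simp add: nested_product_add chD derivation_rules[OF d])
    then have "norm (f n (d (y 0))) \<ge> norm (f n (d (nested_product h n 0 (a n)))) - norm (f n (d (s n)))"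
      by (metis add.commute norm_diff_ineq)
    then show ?thesis
      using A(2)[of n "s n"] character_norm_le[OF ch, of n "d (y 0)"] unfolding a_def by linarith
  qed
  then show False using reals_Archimedean2[of "norm (d (y 0))"] by (meson not_less)
qed

corollary character_derivation_eq_0:
  fixes d :: "'a::complex_banach_algebra \<Rightarrow> 'a"
  assumes char: "\<And>f. f \<in> F \<Longrightarrow> continuous_character f" and d: "derivation d"
    and inv: "\<And>a. \<forall>f\<in>F. f a = 0 \<Longrightarrow> \<forall>f\<in>F. f (d a) = 0"
    and f: "f \<in> F"
  shows "f (d a) = 0"
proof (rule bounded_character_derivation_eq_0[OF char d inv _ f])
  show "bounded_linear (\<lambda>a. g (d a))" if "g \<in> F" for g
    by (rule bounded_if_finitely_many_unbounded[OF char d inv finite_unbounded_characters[OF char d] that])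
qed

section \<open>Derivations that preserve quasinilpotence\<close>

text \<open>
  If no two vectors are independent, every vector is a multiple of one vector \<open>u\<close>, and the
  eigenvalue of \<open>a\<close> at \<open>u\<close> depends multiplicatively on \<open>a\<close>.
\<close>

lemma (in irreducible_banach_representation) one_dimensional_character:
  assumes one: "\<And>B. B \<subseteq> X \<Longrightarrow> card B = 2 \<Longrightarrow> cdependent B"
  shows "\<exists>f. continuous_character f \<and> (\<forall>a. \<forall>x\<in>X. p a x = f a *\<^sub>C x)"
proof -
  obtain a0 u where "u \<in> X" "p a0 u \<noteq> 0" by (rule nontrivial)
  then have u: "u \<in> X" "u \<noteq> 0" by auto
  have multiple: "\<exists>c. x = c *\<^sub>C u" if x: "x \<in> X" for x
  proof (rule ccontr)
    assume no: "\<nexists>c. x = c *\<^sub>C u"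
    then have "x \<noteq> u" by (metis scaleC_one)
    moreover have "x \<notin> complex_vector.span {u}"
      using no by (auto simp: complex_vector.span_singleton)
    then have "\<not> cdependent {x, u}"
      using u complex_vector.independent_insert[of x "{u}"] \<open>x \<noteq> u\<close> by simp
    ultimately show False using one[of "{x, u}"] x u by simp
  qed
  have "\<forall>a. \<exists>c. p a u = c *\<^sub>C u" using multiple u by simp
  then obtain f where f: "\<And>a. p a u = f a *\<^sub>C u" by metis
  have cancel: "b = c" if "b *\<^sub>C u = c *\<^sub>C u" for b c
    using that u by simp
  obtain M where M: "M \<ge> 0" "\<forall>a. \<forall>x\<in>X. norm (p a x) \<le> M * norm a * norm x"
    using act_bound by blast
  show ?thesis
  proof (intro exI[of _ f] conjI allI ballI)
    have "f (a + b) = f a + f b" "f (r *\<^sub>R a) = r *\<^sub>R f a" "norm (f a) \<le> norm a * M"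
      "f (c *\<^sub>C a) = c * f a" "f (a * b) = f a * f b" for a b r c
    proof -
      show "f (a + b) = f a + f b"
        by (rule cancel) (use u in \<open>simp add: scaleC_add_left flip: f\<close>)
      show "f (r *\<^sub>R a) = r *\<^sub>R f a"
        by (rule cancel) (use u in \<open>simp add: scaleC.scaleR_left scaleR_act flip: f\<close>)
      show "f (c *\<^sub>C a) = c * f a"
        by (rule cancel) (use u in \<open>simp flip: f scaleC_scaleC\<close>)
      show "f (a * b) = f a * f b"
      proof (rule cancel)
        have "f (a * b) *\<^sub>C u = p a (p b u)" using u by (simp flip: f)
        also have "\<dots> = f b *\<^sub>C f a *\<^sub>C u" using u by (simp only: f act_scale)
        finally show "f (a * b) *\<^sub>C u = (f a * f b) *\<^sub>C u" by (simp add: mult.commute)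
      qed
      have "norm (f a) * norm u \<le> M * norm a * norm u"
        using M(2)[rule_format, of u a] u by (simp add: f norm_scaleC)
      then show "norm (f a) \<le> norm a * M" using u by (simp add: mult.commute)
    qed
    moreover have "f a \<noteq> 0" if "p a u \<noteq> 0" for a
      using that f by (auto simp: scaleC.zero_left)
    then have "\<exists>a. f a \<noteq> 0" using annihilated_eq_0 u by blast
    ultimately show "continuous_character f"
      unfolding continuous_character_def by (intro conjI bounded_linear_intro[where K = M]) auto
    fix a x assume "x \<in> X"
    then obtain c where "x = c *\<^sub>C u" using multiple by blast
    then show "p a x = f a *\<^sub>C x" using u by (simp add: f mult.commute)
  qed
qed

lemma character_quasinilpotent_eq_0:
  assumes f: "continuous_character f" and x: "x \<in> quasinilpotents"
  shows "f x = 0"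
proof (rule ccontr)
  assume "f x \<noteq> 0"
  then have "f x \<notin> spectrum x" using x by (simp add: quasinilpotents_def)
  then obtain b where "b * x - f x *\<^sub>C b = x" using notin_spectrumD \<open>f x \<noteq> 0\<close> by blast
  then have "f (b * x - f x *\<^sub>C b) = f x" by simp
  then show False using \<open>f x \<noteq> 0\<close> by (simp add: continuous_characterD[OF f])
qed

theorem theorem4p1:
  fixes d :: "'a::complex_banach_algebra \<Rightarrow> 'a"
  assumes "property_beta TYPE('i) TYPE('x::complex_banach) TYPE('a)"
    and "derivation d"
    and "d ` quasinilpotents \<subseteq> quasinilpotents"
  shows "range d \<subseteq> jacobson_radical"
proof -
  obtain I :: "'i set" and X :: "'i \<Rightarrow> 'x set" and p :: "'i \<Rightarrow> 'a \<Rightarrow> 'x \<Rightarrow> 'x" where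
    beta: "(\<forall>i\<in>I. continuous_representation (X i) (p i) \<and> irreducible_representation (X i) (p i)) \<and>
      (\<Inter>i\<in>I. rep_kernel (X i) (p i)) = jacobson_radical \<and>
      (\<forall>i\<in>I. (\<exists>B\<subseteq>X i. card B = 2 \<and> \<not> cdependent B) \<longrightarrow>
         (\<exists>q. q * q = 0 \<and> q \<notin> rep_kernel (X i) (p i)))"
    using assms(1) unfolding property_beta_def by (elim exE) (erule that)
  then have rep: "\<And>i. i \<in> I \<Longrightarrow> continuous_representation (X i) (p i) \<and> irreducible_representation (X i) (p i)"
    and rad: "(\<Inter>i\<in>I. rep_kernel (X i) (p i)) = jacobson_radical"
    and nil: "\<And>i. i \<in> I \<Longrightarrow> \<exists>B\<subseteq>X i. card B = 2 \<and> \<not> cdependent B \<Longrightarrow>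
               \<exists>q. q * q = 0 \<and> q \<notin> rep_kernel (X i) (p i)"
    by simp_all
  note d = assms(2)
  \<comment> \<open>The representations of dimension at least 2; on the others the algebra acts by characters.\<close>
  define H where "H = {i \<in> I. \<exists>B\<subseteq>X i. card B = 2 \<and> \<not> cdependent B}"
  have irr: "irreducible_banach_representation (X i) (p i)" if "i \<in> I" for i
    using rep[OF that] by unfold_locales auto
  have nontriv: "\<exists>y::'a. y \<noteq> 0" if i: "i \<in> I" for i
  proof -
    interpret irreducible_banach_representation "X i" "p i" by (rule irr[OF i])
    obtain a x where "x \<in> X i" "p i a x \<noteq> 0" by (rule nontrivial)
    then have "a \<noteq> 0" by auto
    then show ?thesis by blast
  qed
  have high: "p i (d a) x = 0" if i: "i \<in> H" and x: "x \<in> X i" for i a x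
  proof -
    have iI: "i \<in> I" using i by (simp add: H_def)
    obtain y :: 'a where y: "y \<noteq> 0" using nontriv[OF iI] by blast
    interpret irreducible_banach_representation "X i" "p i" by (rule irr[OF iI])
    interpret nilpotent_derivation "X i" "p i" d
      by unfold_locales (use d assms(3) square_zero_quasinilpotent[OF _ y] in auto)
    have "\<exists>B\<subseteq>X i. card B = 2 \<and> \<not> cdependent B" using i by (simp add: H_def)
    from nil[OF iI this] obtain q where q: "q * q = 0" "q \<notin> rep_kernel (X i) (p i)" by blast
    then obtain v where "v \<in> X i" "p i q v \<noteq> 0" by (auto simp: rep_kernel_def)
    then show ?thesis by (rule derivation_into_kernel[OF q(1) _ _ x])
  qed
  have "\<exists>f. continuous_character f \<and> (\<forall>a. \<forall>x\<in>X i. p i a x = f a *\<^sub>C x)" if i: "i \<in> I - H" for i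
  proof -
    interpret irreducible_banach_representation "X i" "p i" by (rule irr) (use i in simp)
    show ?thesis
    proof (rule one_dimensional_character)
      show "cdependent B" if "B \<subseteq> X i" "card B = 2" for B
        using that i by (auto simp: H_def)
    qed
  qed
  then obtain f where f: "\<And>i. i \<in> I - H \<Longrightarrow> continuous_character (f i)"
    and pf: "\<And>i a x. i \<in> I - H \<Longrightarrow> x \<in> X i \<Longrightarrow> p i a x = f i a *\<^sub>C x"
    by metis
  have radI: "a \<in> jacobson_radical"
    if "\<And>i x. i \<in> H \<Longrightarrow> x \<in> X i \<Longrightarrow> p i a x = 0" "\<And>i. i \<in> I - H \<Longrightarrow> f i a = 0" for a
    unfolding rad[symmetric] rep_kernel_def
    using that pf by (auto simp: scaleC.zero_left) (metis DiffI scaleC.zero_left)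
  have char0: "f i (d a) = 0" if i: "i \<in> I - H" for i a
  proof (rule character_derivation_eq_0[where F = "f ` (I - H)" and f = "f i" and d = d])
    fix a assume a: "\<forall>g\<in>f ` (I - H). g a = 0"
    have "f i (d a) = 0" if i: "i \<in> I - H" for i
    proof -
      note ch = continuous_characterD[OF f[OF i]]
      obtain y :: 'a where y: "y \<noteq> 0" using nontriv i by blast
      \<comment> \<open>\<open>d a\<close> acts as 0 in dimension at least 2, and \<open>a\<close> is killed by the characters.  Applying \<open>d\<close>
        to the product stays quasinilpotent, and its value at \<open>f i\<close> is the square of \<open>f i (d a)\<close>.\<close>
      have "d a * a \<in> jacobson_radical"
      proof (rule radI)
        fix j x assume j: "j \<in> H" "x \<in> X j"
        then interpret irreducible_banach_representation "X j" "p j" by (intro irr) (simp add: H_def)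
        show "p j (d a * a) x = 0" using high[OF j(1)] j(2) by simp
      next
        fix j assume "j \<in> I - H"
        then show "f j (d a * a) = 0" using a f by (simp add: continuous_characterD(3))
      qed
      then have "d (d a * a) \<in> quasinilpotents"
        using radical_subset_quasinilpotents[OF _ y] assms(3) by blast
      then have "f i (d (d a * a)) = 0" by (rule character_quasinilpotent_eq_0[OF f[OF i]])
      then show ?thesis using a i by (simp add: ch derivation_rules[OF d])
    qed
    then show "\<forall>g\<in>f ` (I - H). g (d a) = 0" by blast
  qed (use f d i in auto)
  show ?thesis using radI high char0 by blast
qed

end
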